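(* For a typical map $f\in\mathcal C[0,1]$ the entropy function $\mu\in\mathcal M_f\mapsto h_\mu(f)\in[0,+\infty]$ is neither upper semi-continuous nor lower semi-continuous. Moreover, the restriction of the entropy function to the set $\mathcal O_f$ of pseudo-physical measures is neither upper nor lower semi-continuous.
   Context: $\mathcal C[0,1]$ is the space of continuous maps of $[0,1]$ to itself, with the uniform metric. A property is typical ("holds for a typical map") if there is a dense $G_\delta$ subset $G\subset\mathcal C[0,1]$ such that all $f\in G$ have the property. "Measure" means Borel probability measure on $[0,1]$. Fix a countable dense subset $\{\Psi_i\}_{i\in\mathbb N}$ of $\mathcal C[0,1]$ and let $\mathrm{dist}(\mu,\nu)=\sum_{i\ge1}2^{-i}\left|\int\Psi_i\,d\mu-\int\Psi_i\,d\nu\right|$, which induces the weak$^*$ topology. $\mathcal M_f$ is the set of $f$-invariant measures with this topology, and $h_\mu(f)$ is the metric (Kolmogorov–Sinai) entropy. For $x\in[0,1]$, $p\omega(x)$ is the set of weak$^*$ limits of convergent subsequences of $\frac1n\sum_{j=0}^{n-1}\delta_{f^j(x)}$, and $\mathrm{dist}(p\omega(x),\mu)=\inf_{\nu\in p\omega(x)}\mathrm{dist}(\nu,\mu)$. A measure $\mu$ is pseudo-physical for $f$ if for every $\varepsilon>0$ the set $\{x\in[0,1]:\mathrm{dist}(p\omega(x),\mu)<\varepsilon\}$ has positive Lebesgue measure; $\mathcal O_f\subset\mathcal M_f$ is the set of pseudo-physical measures for $f$. *)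

theory Defs
  imports "HOL-Probability.Probability"
begin

section \<open>Continuous self-maps of the unit interval\<close>

text \<open>Elements of the function space are extensional, i.e. they are \<^const>\<open>undefined\<close> outside
  \<open>[0,1]\<close>, so that equality of maps is equality on the interval.\<close>

definition C01_metric :: "(real \<Rightarrow> real) metric" where
  "C01_metric = cfunspace (top_of_set {0..1}) (submetric euclidean_metric {0..1})"

abbreviation C01 :: "(real \<Rightarrow> real) set" where
  "C01 \<equiv> mspace C01_metric"

definition typical :: "((real \<Rightarrow> real) \<Rightarrow> bool) \<Rightarrow> bool" where
  "typical P \<longleftrightarrow>
     (\<exists>G. gdelta_in (mtopology_of C01_metric) G \<and>
          mtopology_of C01_metric closure_of G = C01 \<and>
          (\<forall>f\<in>G. P f))"

section \<open>Borel probability measures and the weak-star topology\<close>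

definition borel01 :: "real measure" where
  "borel01 = restrict_space borel {0..1}"

definition prob01 :: "real measure set" where
  "prob01 = {\<mu>. prob_space \<mu> \<and> sets \<mu> = sets borel01}"

definition dense_sequence :: "(nat \<Rightarrow> real \<Rightarrow> real) \<Rightarrow> bool" where
  "dense_sequence \<Psi> \<longleftrightarrow> range \<Psi> \<subseteq> C01 \<and> mtopology_of C01_metric closure_of range \<Psi> = C01"

text \<open>The sequence is indexed from \<open>0\<close>, hence the weights \<open>2\<^sup>-\<^sup>(\<^sup>i\<^sup>+\<^sup>1\<^sup>)\<close>. The series converges for probability
  measures. For other arguments \<^const>\<open>infsum\<close> is still nonnegative, unlike \<^const>\<open>suminf\<close>, and
  \<^locale>\<open>Metric_space\<close> requires this outside the carrier too.\<close>

definition wdist :: "(nat \<Rightarrow> real \<Rightarrow> real) \<Rightarrow> real measure \<Rightarrow> real measure \<Rightarrow> real" where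
  "wdist \<Psi> \<mu> \<nu> =
     (\<Sum>\<^sub>\<infinity>i. (1 / 2) ^ Suc i * \<bar>integral\<^sup>L \<mu> (\<Psi> i) - integral\<^sup>L \<nu> (\<Psi> i)\<bar>)"

definition weak_star :: "(nat \<Rightarrow> real \<Rightarrow> real) \<Rightarrow> real measure topology" where
  "weak_star \<Psi> = Metric_space.mtopology prob01 (wdist \<Psi>)"

definition invariant_measures :: "(real \<Rightarrow> real) \<Rightarrow> real measure set" where
  "invariant_measures f = {\<mu> \<in> prob01. distr \<mu> borel01 f = \<mu>}"

section \<open>Pseudo-physical measures\<close>

text \<open>The average of the Dirac measures at \<open>x, f x, \<dots>, f\<^sup>n\<^sup>-\<^sup>1 x\<close>, as the image of the uniform
  measure on \<open>{0, \<dots>, n - 1}\<close>. For \<open>n = 0\<close> this is the null measure, which is irrelevant for limits.\<close>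

definition empirical :: "(real \<Rightarrow> real) \<Rightarrow> real \<Rightarrow> nat \<Rightarrow> real measure" where
  "empirical f x n = distr (uniform_count_measure {..<n}) borel01 (\<lambda>j. (f ^^ j) x)"

definition p_omega :: "(nat \<Rightarrow> real \<Rightarrow> real) \<Rightarrow> (real \<Rightarrow> real) \<Rightarrow> real \<Rightarrow> real measure set" where
  "p_omega \<Psi> f x =
     {\<mu>. \<exists>r. strict_mono r \<and> limitin (weak_star \<Psi>) (\<lambda>k. empirical f x (r k)) \<mu> sequentially}"

definition wdist_set ::
    "(nat \<Rightarrow> real \<Rightarrow> real) \<Rightarrow> real measure set \<Rightarrow> real measure \<Rightarrow> real" where
  "wdist_set \<Psi> A \<mu> = (INF \<nu>\<in>A. wdist \<Psi> \<nu> \<mu>)"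

definition pseudo_physical ::
    "(nat \<Rightarrow> real \<Rightarrow> real) \<Rightarrow> (real \<Rightarrow> real) \<Rightarrow> real measure \<Rightarrow> bool" where
  "pseudo_physical \<Psi> f \<mu> \<longleftrightarrow>
     (\<forall>\<epsilon>>0. 0 < emeasure lebesgue {x \<in> {0..1}. wdist_set \<Psi> (p_omega \<Psi> f x) \<mu> < \<epsilon>})"

definition pseudo_physical_measures ::
    "(nat \<Rightarrow> real \<Rightarrow> real) \<Rightarrow> (real \<Rightarrow> real) \<Rightarrow> real measure set" where
  "pseudo_physical_measures \<Psi> f = {\<mu> \<in> prob01. pseudo_physical \<Psi> f \<mu>}"

section \<open>Kolmogorov--Sinai entropy\<close>

definition finite_partitions :: "'a measure \<Rightarrow> 'a set set set" where
  "finite_partitions \<mu> = {P. finite P \<and> P \<subseteq> sets \<mu> \<and> partition_on (space \<mu>) P}"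

text \<open>The convention \<open>0 ln 0 = 0\<close> is automatic.\<close>

definition partition_entropy :: "'a measure \<Rightarrow> 'a set set \<Rightarrow> real" where
  "partition_entropy \<mu> P = - (\<Sum>A\<in>P. measure \<mu> A * ln (measure \<mu> A))"

text \<open>The join of \<open>P, f\<^sup>-\<^sup>1 P, \<dots>, f\<^sup>-\<^sup>(\<^sup>n\<^sup>-\<^sup>1\<^sup>) P\<close>: its cells are the nonempty sets of points whose first
  \<open>n\<close> iterates visit the cells \<open>c 0, \<dots>, c (n - 1)\<close> of \<open>P\<close> in this order.\<close>

definition iterated_join :: "'a measure \<Rightarrow> ('a \<Rightarrow> 'a) \<Rightarrow> 'a set set \<Rightarrow> nat \<Rightarrow> 'a set set" where
  "iterated_join \<mu> f P n =
     (\<lambda>c. {x \<in> space \<mu>. \<forall>i<n. (f ^^ i) x \<in> c i}) ` ({..<n} \<rightarrow>\<^sub>E P) - {{}}"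

definition entropy_wrt :: "'a measure \<Rightarrow> ('a \<Rightarrow> 'a) \<Rightarrow> 'a set set \<Rightarrow> real" where
  "entropy_wrt \<mu> f P = lim (\<lambda>n. partition_entropy \<mu> (iterated_join \<mu> f P n) / real n)"

definition ks_entropy :: "('a \<Rightarrow> 'a) \<Rightarrow> 'a measure \<Rightarrow> ereal" where
  "ks_entropy f \<mu> = (SUP P\<in>finite_partitions \<mu>. ereal (entropy_wrt \<mu> f P))"

section \<open>Semicontinuity\<close>

definition upper_semicontinuous_map :: "'a topology \<Rightarrow> ('a \<Rightarrow> 'b::linorder) \<Rightarrow> bool" where
  "upper_semicontinuous_map X h \<longleftrightarrow> (\<forall>a. openin X {x \<in> topspace X. h x < a})"

definition lower_semicontinuous_map :: "'a topology \<Rightarrow> ('a \<Rightarrow> 'b::linorder) \<Rightarrow> bool" where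
  "lower_semicontinuous_map X h \<longleftrightarrow> (\<forall>a. openin X {x \<in> topspace X. a < h x})"

section \<open>Basic facts\<close>

lemma C01_iff:
  "f \<in> C01 \<longleftrightarrow> f \<in> {0..1} \<rightarrow> {0..1} \<and> f \<in> extensional {0..1} \<and> continuous_on {0..1} f"
proof -
  interpret S: Metric_space "{0..1::real}" dist
    by (rule Met_TC.subspace) simp
  have top: "mtopology_of (submetric euclidean_metric {0..1::real}) = top_of_set {0..1}"
    by (simp add: mtopology_of_submetric)
  have bdd: "S.mbounded (f ` {0..1})" if "f \<in> {0..1} \<rightarrow> {0..1}"
  proof -
    have "f ` {0..1} \<subseteq> S.mcball 0 1"
      using that by (auto simp: S.mcball_def dist_real_def Pi_iff)
    then show ?thesis unfolding S.mbounded_def by blast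
  qed
  have cont: "continuous_map (top_of_set {0..1}) (top_of_set {0..1}) f \<longleftrightarrow>
      continuous_on {0..1} f" if "f \<in> {0..1} \<rightarrow> {0..1}"
    using that by (simp add: continuous_map_in_subtopology image_subset_iff_funcset)
  show ?thesis
    unfolding C01_metric_def mspace_cfunspace top using bdd cont by simp blast
qed

lemma C01_mdist_lt:
  assumes "f \<in> C01" "g \<in> C01" "mdist C01_metric f g < e" "x \<in> {0..1}"
  shows "\<bar>f x - g x\<bar> < e"
proof -
  have "mdist (submetric euclidean_metric {0..1}) (f x) (g x) \<le> mdist C01_metric f g"
    unfolding C01_metric_def
    by (rule mdist_cfunspace_imp_mdist_le[OF assms(1,2)[unfolded C01_metric_def] order_refl])
       (use assms(4) in simp)
  with assms(3) show ?thesis by (simp add: dist_real_def)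
qed

lemma space_borel01 [simp]: "space borel01 = {0..1}"
  by (simp add: borel01_def space_restrict_space)

lemma prob01_space: "\<mu> \<in> prob01 \<Longrightarrow> space \<mu> = {0..1}"
  using sets_eq_imp_space_eq[of \<mu> borel01] by (simp add: prob01_def)

lemma C01_measurable: "f \<in> C01 \<Longrightarrow> f \<in> borel_measurable borel01"
  by (simp add: C01_iff borel01_def borel_measurable_continuous_on_restrict)

lemma C01_integrable:
  assumes "\<mu> \<in> prob01" "f \<in> C01"
  shows "integrable \<mu> f"
proof -
  interpret prob_space \<mu> using assms by (simp add: prob01_def)
  have "f \<in> borel_measurable \<mu>"
    using C01_measurable[OF assms(2)] assms(1) measurable_cong_sets[of \<mu> borel01]
    by (auto simp: prob01_def)
  moreover have "AE x in \<mu>. norm (f x) \<le> 1"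
    using assms(2) prob01_space[OF assms(1)] by (intro AE_I2) (auto simp: C01_iff Pi_iff)
  ultimately show ?thesis by (intro integrable_const_bound)
qed

lemma C01_integral_bounds:
  assumes "\<mu> \<in> prob01" "f \<in> C01"
  shows "integral\<^sup>L \<mu> f \<in> {0..1}"
proof -
  interpret prob_space \<mu> using assms by (simp add: prob01_def)
  have "f x \<in> {0..1}" if "x \<in> space \<mu>" for x
    using assms(2) that prob01_space[OF assms(1)] by (auto simp: C01_iff)
  then have *: "AE x in \<mu>. 0 \<le> f x" "AE x in \<mu>. f x \<le> 1" by auto
  show ?thesis
    using integral_ge_const[OF C01_integrable[OF assms] *(1)]
      integral_le_const[OF C01_integrable[OF assms] *(2)] by simp
qed

lemma wdist_summable:
  assumes "range \<Psi> \<subseteq> C01" "\<mu> \<in> prob01" "\<nu> \<in> prob01"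
  shows "(\<lambda>i. (1 / 2) ^ Suc i * \<bar>integral\<^sup>L \<mu> (\<Psi> i) - integral\<^sup>L \<nu> (\<Psi> i)\<bar>) summable_on UNIV"
proof (rule summable_nonneg_imp_summable_on)
  show "summable (\<lambda>i. (1 / 2) ^ Suc i * \<bar>integral\<^sup>L \<mu> (\<Psi> i) - integral\<^sup>L \<nu> (\<Psi> i)\<bar>)"
  proof (rule summable_comparison_test')
    show "summable (\<lambda>i. (1 / 2 :: real) ^ Suc i)"
      by (subst summable_Suc_iff) (simp add: summable_geometric)
    fix i :: nat
    have "\<bar>integral\<^sup>L \<mu> (\<Psi> i) - integral\<^sup>L \<nu> (\<Psi> i)\<bar> \<le> 1"
      using C01_integral_bounds[of \<mu> "\<Psi> i"] C01_integral_bounds[of \<nu> "\<Psi> i"] assms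
      by (auto simp: abs_le_iff image_subset_iff)
    then show "norm ((1 / 2) ^ Suc i * \<bar>integral\<^sup>L \<mu> (\<Psi> i) - integral\<^sup>L \<nu> (\<Psi> i)\<bar>) \<le> (1 / 2) ^ Suc i"
      by (simp add: abs_mult mult_left_le)
  qed
qed simp

lemma prob01_eqI:
  assumes \<mu>: "\<mu> \<in> prob01" and \<nu>: "\<nu> \<in> prob01"
    and eq: "\<And>f. f \<in> C01 \<Longrightarrow> integral\<^sup>L \<mu> f = integral\<^sup>L \<nu> f"
  shows "\<mu> = \<nu>"
proof -
  define \<phi> where "\<phi> a n = restrict (\<lambda>x. max 0 (min 1 (1 - real n * (x - a)))) {0..1}" for a n
  have \<phi>: "\<phi> a n \<in> C01" for a n
  proof -
    have "continuous_on {0..1} (\<lambda>x. max 0 (min 1 (1 - real n * (x - a))))"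
      by (intro continuous_intros)
    then have "continuous_on {0..1} (\<phi> a n)"
      by (rule continuous_on_eq) (simp add: \<phi>_def)
    then show ?thesis
      unfolding C01_iff by (auto simp: \<phi>_def)
  qed
  have lim: "(\<lambda>n. integral\<^sup>L \<rho> (\<phi> a n)) \<longlonglongrightarrow> measure \<rho> ({..a} \<inter> {0..1})"
    if \<rho>: "\<rho> \<in> prob01" for \<rho> a
  proof -
    interpret prob_space \<rho> using \<rho> by (simp add: prob01_def)
    have sp: "space \<rho> = {0..1}" by (rule prob01_space[OF \<rho>])
    have A: "{..a} \<inter> {0..1} \<in> sets \<rho>"
      using \<rho> by (auto simp: prob01_def borel01_def sets_restrict_space)
    have "(\<lambda>n. integral\<^sup>L \<rho> (\<phi> a n)) \<longlonglongrightarrow> integral\<^sup>L \<rho> (indicator ({..a} \<inter> {0..1}))"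
    proof (rule integral_dominated_convergence[where w = "\<lambda>_. 1"])
      show "AE x in \<rho>. (\<lambda>n. \<phi> a n x) \<longlonglongrightarrow> indicator ({..a} \<inter> {0..1}) x"
      proof (rule AE_I2)
        fix x assume x: "x \<in> space \<rho>"
        show "(\<lambda>n. \<phi> a n x) \<longlonglongrightarrow> indicator ({..a} \<inter> {0..1}) x"
        proof (cases "x \<le> a")
          case True
          have "\<phi> a n x = 1" for n
            using True x sp mult_nonneg_nonpos[of "real n" "x - a"] by (auto simp: \<phi>_def)
          with True x sp show ?thesis by simp
        next
          case False
          then obtain N where N: "1 < real N * (x - a)"
            using ex_less_of_nat_mult[of "x - a" 1] by auto
          have "\<phi> a n x = 0" if "n \<ge> N" for n
          proof -
            have "real N * (x - a) \<le> real n * (x - a)"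
              using that False by (intro mult_right_mono) auto
            with N x sp show ?thesis by (auto simp: \<phi>_def)
          qed
          then have "eventually (\<lambda>n. \<phi> a n x = 0) sequentially"
            by (rule eventually_sequentiallyI)
          with False show ?thesis by (auto intro: tendsto_eventually)
        qed
      qed
      show "AE x in \<rho>. norm (\<phi> a n x) \<le> 1" for n
        using sp by (intro AE_I2) (auto simp: \<phi>_def)
    qed (use A C01_integrable[OF \<rho> \<phi>] in auto)
    with A show ?thesis by simp
  qed
  have meas: "measure \<mu> ({..a} \<inter> {0..1}) = measure \<nu> ({..a} \<inter> {0..1})" for a
    using lim[OF \<mu>, of a] lim[OF \<nu>, of a] eq[OF \<phi>] LIMSEQ_unique by fastforce
  have id: "id \<in> borel_measurable \<rho>" if "\<rho> \<in> prob01" for \<rho>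
  proof -
    have "id \<in> borel_measurable borel01"
      unfolding borel01_def id_def by (intro measurable_restrict_space1) simp
    then show ?thesis
      using that by (simp add: prob01_def cong: measurable_cong_sets)
  qed
  have dist: "real_distribution (distr \<rho> borel id)" if "\<rho> \<in> prob01" for \<rho>
  proof -
    interpret prob_space \<rho> using that by (simp add: prob01_def)
    show ?thesis using id[OF that] by simp
  qed
  have cdf: "cdf (distr \<rho> borel id) a = measure \<rho> ({..a} \<inter> {0..1})" if "\<rho> \<in> prob01" for \<rho> a
    using id[OF that] prob01_space[OF that] by (simp add: cdf_def measure_distr)
  have "distr \<mu> borel id = distr \<nu> borel id"
  proof (rule cdf_unique)
    show "cdf (distr \<mu> borel id) = cdf (distr \<nu> borel id)"
      by (rule ext) (simp only: cdf[OF \<mu>] cdf[OF \<nu>] meas)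
  qed (use dist \<mu> \<nu> in auto)
  moreover have "emeasure (distr \<rho> borel id) A = emeasure \<rho> A"
    if "\<rho> \<in> prob01" "A \<in> sets borel01" for \<rho> A
  proof -
    have "A \<in> sets borel" "A \<subseteq> {0..1}"
      using that(2) by (auto simp: borel01_def sets_restrict_space)
    then show ?thesis
      using id[OF that(1)] prob01_space[OF that(1)] by (simp add: emeasure_distr Int_absorb2)
  qed
  ultimately have "emeasure \<mu> A = emeasure \<nu> A" if "A \<in> sets borel01" for A
    using \<mu> \<nu> that by metis
  with \<mu> \<nu> show ?thesis
    by (intro measure_eqI) (auto simp: prob01_def)
qed

lemma dense_sequence_approx:
  assumes "dense_sequence \<Psi>" "f \<in> C01" "e > 0"
  obtains i where "\<And>x. x \<in> {0..1} \<Longrightarrow> \<bar>f x - \<Psi> i x\<bar> < e"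
proof -
  interpret Metric_space "C01" "mdist C01_metric" by (rule Metric_space_mspace_mdist)
  have "f \<in> mtopology closure_of range \<Psi>"
    using assms by (auto simp: dense_sequence_def mtopology_of_def)
  with \<open>e > 0\<close> obtain i where "\<Psi> i \<in> mball f e"
    unfolding metric_closure_of by blast
  then have *: "mdist C01_metric f (\<Psi> i) < e" "\<Psi> i \<in> C01" by auto
  have "\<bar>f x - \<Psi> i x\<bar> < e" if "x \<in> {0..1}" for x
    by (rule C01_mdist_lt[OF assms(2) *(2,1) that])
  then show ?thesis by (rule that)
qed

lemma Metric_space_wdist:
  assumes \<Psi>: "dense_sequence \<Psi>"
  shows "Metric_space prob01 (wdist \<Psi>)"
proof
  have sub: "range \<Psi> \<subseteq> C01" using \<Psi> by (simp add: dense_sequence_def)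
  show nonneg: "0 \<le> wdist \<Psi> \<mu> \<nu>" for \<mu> \<nu>
    by (auto simp: wdist_def intro!: infsum_nonneg)
  show "wdist \<Psi> \<mu> \<nu> = wdist \<Psi> \<nu> \<mu>" for \<mu> \<nu>
    by (simp add: wdist_def abs_minus_commute)
  fix \<mu> \<nu> assume \<mu>: "\<mu> \<in> prob01" and \<nu>: "\<nu> \<in> prob01"
  show "wdist \<Psi> \<mu> \<nu> = 0 \<longleftrightarrow> \<mu> = \<nu>"
  proof
    assume 0: "wdist \<Psi> \<mu> \<nu> = 0"
    have \<Psi>eq: "integral\<^sup>L \<mu> (\<Psi> i) = integral\<^sup>L \<nu> (\<Psi> i)" for i
      using nonneg_infsum_le_0D[OF _ wdist_summable[OF sub \<mu> \<nu>], of i] 0 by (simp add: wdist_def)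
    show "\<mu> = \<nu>"
    proof (rule prob01_eqI[OF \<mu> \<nu>])
      fix f assume f: "f \<in> C01"
      have "\<bar>integral\<^sup>L \<mu> f - integral\<^sup>L \<nu> f\<bar> \<le> 0 + e" if "e > 0" for e
      proof -
        obtain i where i: "\<And>x. x \<in> {0..1} \<Longrightarrow> \<bar>f x - \<Psi> i x\<bar> < e / 2"
          using dense_sequence_approx[OF \<Psi> f, of "e / 2"] \<open>e > 0\<close> by auto
        have "\<bar>integral\<^sup>L \<rho> f - integral\<^sup>L \<rho> (\<Psi> i)\<bar> \<le> e / 2" if \<rho>: "\<rho> \<in> prob01" for \<rho>
        proof -
          interpret prob_space \<rho> using \<rho> by (simp add: prob01_def)
          have int: "integrable \<rho> f" "integrable \<rho> (\<Psi> i)"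
            using C01_integrable[OF \<rho>] f sub by auto
          have "\<bar>integral\<^sup>L \<rho> f - integral\<^sup>L \<rho> (\<Psi> i)\<bar> = \<bar>\<integral>x. f x - \<Psi> i x \<partial>\<rho>\<bar>"
            using int by simp
          also have "\<dots> \<le> (\<integral>x. \<bar>f x - \<Psi> i x\<bar> \<partial>\<rho>)" by (rule integral_abs_bound)
          also have "\<dots> \<le> e / 2"
            using int i prob01_space[OF \<rho>]
            by (intro integral_le_const) (auto intro!: AE_I2 less_imp_le)
          finally show ?thesis .
        qed
        from this[OF \<mu>] this[OF \<nu>] show ?thesis unfolding \<Psi>eq by linarith
      qed
      then have "\<bar>integral\<^sup>L \<mu> f - integral\<^sup>L \<nu> f\<bar> \<le> 0" by (rule field_le_epsilon)
      then show "integral\<^sup>L \<mu> f = integral\<^sup>L \<nu> f" by simp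
    qed
  qed (simp add: wdist_def)
  fix \<rho> assume \<rho>: "\<rho> \<in> prob01"
  note s = wdist_summable[OF sub]
  show "wdist \<Psi> \<mu> \<rho> \<le> wdist \<Psi> \<mu> \<nu> + wdist \<Psi> \<nu> \<rho>"
    unfolding wdist_def infsum_add[OF s[OF \<mu> \<nu>] s[OF \<nu> \<rho>], symmetric]
  proof (rule infsum_mono[OF s[OF \<mu> \<rho>] summable_on_add[OF s[OF \<mu> \<nu>] s[OF \<nu> \<rho>]]])
    fix i :: nat
    have "\<bar>integral\<^sup>L \<mu> (\<Psi> i) - integral\<^sup>L \<rho> (\<Psi> i)\<bar>
        \<le> \<bar>integral\<^sup>L \<mu> (\<Psi> i) - integral\<^sup>L \<nu> (\<Psi> i)\<bar> + \<bar>integral\<^sup>L \<nu> (\<Psi> i) - integral\<^sup>L \<rho> (\<Psi> i)\<bar>"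
      by linarith
    then show "(1 / 2) ^ Suc i * \<bar>integral\<^sup>L \<mu> (\<Psi> i) - integral\<^sup>L \<rho> (\<Psi> i)\<bar>
        \<le> (1 / 2) ^ Suc i * \<bar>integral\<^sup>L \<mu> (\<Psi> i) - integral\<^sup>L \<nu> (\<Psi> i)\<bar>
          + (1 / 2) ^ Suc i * \<bar>integral\<^sup>L \<nu> (\<Psi> i) - integral\<^sup>L \<rho> (\<Psi> i)\<bar>"
      unfolding distrib_left[symmetric] by (rule mult_left_mono) simp
  qed
qed

lemma topspace_weak_star: "dense_sequence \<Psi> \<Longrightarrow> topspace (weak_star \<Psi>) = prob01"
  unfolding weak_star_def by (rule Metric_space.topspace_mtopology[OF Metric_space_wdist])

lemma C01_funpow: "f \<in> C01 \<Longrightarrow> x \<in> {0..1} \<Longrightarrow> (f ^^ n) x \<in> {0..1}"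
  by (induction n) (auto simp: C01_iff Pi_iff)

lemma empirical_in_prob01:
  assumes "f \<in> C01" "x \<in> {0..1}" "n > 0"
  shows "empirical f x n \<in> prob01"
proof -
  have "prob_space (uniform_count_measure {..<n})"
    using assms(3) by (intro prob_space_uniform_count_measure) auto
  moreover have "(\<lambda>j. (f ^^ j) x) \<in> uniform_count_measure {..<n} \<rightarrow>\<^sub>M borel01"
    using C01_funpow[OF assms(1,2)] by (simp add: measurable_def space_uniform_count_measure
        sets_uniform_count_measure)
  ultimately show ?thesis
    by (simp add: prob01_def empirical_def prob_space.prob_space_distr)
qed

lemma integral_empirical:
  assumes "f \<in> C01" "x \<in> {0..1}" "g \<in> C01"
  shows "integral\<^sup>L (empirical f x n) g = (\<Sum>j<n. g ((f ^^ j) x)) / real n"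
proof -
  have "(\<lambda>j. (f ^^ j) x) \<in> uniform_count_measure {..<n} \<rightarrow>\<^sub>M borel01"
    using C01_funpow[OF assms(1,2)] by (simp add: measurable_def space_uniform_count_measure
        sets_uniform_count_measure)
  then show ?thesis
    using C01_measurable[OF assms(3)]
    by (simp add: empirical_def integral_distr integral_uniform_count_measure)
qed

end

theory Submission
  imports Defs
begin

text \<open>A typical map has two properties, each guaranteed by countably many open dense conditions.

First, every periodic orbit can be approximated by traps, i.e. by cycles of tiny intervals that are
mapped into one another. Indeed, making the map constant near the points of a periodic orbit is a
small perturbation that creates such a cycle. Since traps persist under perturbation, the maps with a
trap of given size near a given finite sequence form an open set, and a generic map lies in such
a set whenever it lies in its closure (\<open>periodic_shadowed\<close>). All points in a trap have empirical
measures close to that of the periodic orbit, and an interval has positive Lebesgue measure.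
Therefore all measures on periodic orbits are pseudo-physical (\<open>pseudo_physical_periodic\<close>), and so
are their limits (\<open>pseudo_physical_limit\<close>).

Second, there are horseshoes of arbitrarily small diameter: two disjoint intervals, each of which is
stretched across their common hull. They arise near a fixed point by prescribing four values
(\<open>dense_horseshoe_maps\<close>). In a horseshoe, the intermediate value theorem gives periodic points with
any prescribed itinerary (\<open>horseshoe_periodic_itinerary\<close>). Letting the itineraries be the
concatenation of all words of length \<open>m\<close>, a limit for \<open>m \<rightarrow> \<infinity>\<close> of the measures on these orbits
assigns measure \<open>2\<^sup>-\<^sup>k\<close> to each itinerary of length \<open>k\<close>, and hence has entropy at least \<open>ln 2\<close>
(\<open>horseshoe_measure\<close>).

Measures on periodic orbits have entropy \<open>0\<close>. So within a single horseshoe the entropy jumps up in a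
limit, which refutes lower semicontinuity. As the horseshoes shrink, their measures accumulate at the
Dirac measure of a fixed point, where the entropy jumps down; this refutes upper semicontinuity.
Since all measures involved are pseudo-physical as well as invariant, the same sequences work in
both spaces (\<open>entropy_not_semicontinuous\<close>).\<close>

section \<open>Topology of the space of interval maps\<close>

lemma openin_C01I:
  assumes "S \<subseteq> C01"
    and "\<And>f. f \<in> S \<Longrightarrow> \<exists>e>0. \<forall>g\<in>C01. (\<forall>x\<in>{0..1}. \<bar>f x - g x\<bar> < e) \<longrightarrow> g \<in> S"
  shows "openin (mtopology_of C01_metric) S"
proof -
  interpret Metric_space C01 "mdist C01_metric" by (rule Metric_space_mspace_mdist)
  have "\<exists>e>0. mball f e \<subseteq> S" if f: "f \<in> S" for f
  proof -
    obtain e where e: "e > 0" "\<And>g. g \<in> C01 \<Longrightarrow> (\<forall>x\<in>{0..1}. \<bar>f x - g x\<bar> < e) \<Longrightarrow> g \<in> S"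
      using assms(2)[OF f] by blast
    have "g \<in> S" if "g \<in> mball f e" for g
      using that C01_mdist_lt[of f g e] by (intro e(2)) auto
    with e(1) show ?thesis by blast
  qed
  with assms(1) show ?thesis
    unfolding mtopology_of_def openin_mtopology by blast
qed

lemma C01_in_closureI:
  assumes "S \<subseteq> C01" "f \<in> C01"
    and "\<And>e. e > 0 \<Longrightarrow> \<exists>g\<in>S. \<forall>x\<in>{0..1}. \<bar>f x - g x\<bar> < e"
  shows "f \<in> mtopology_of C01_metric closure_of S"
proof -
  interpret Metric_space C01 "mdist C01_metric" by (rule Metric_space_mspace_mdist)
  have "\<exists>g\<in>S. g \<in> mball f e" if e: "e > 0" for e
  proof -
    obtain g where g: "g \<in> S" "\<And>x. x \<in> {0..1} \<Longrightarrow> \<bar>f x - g x\<bar> < e / 2"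
      using assms(3)[OF half_gt_zero[OF e]] by blast
    have "mdist C01_metric f g \<le> e / 2"
      unfolding C01_metric_def using g(2) e
      by (intro mdist_cfunspace_le) (auto simp: dist_real_def intro: less_imp_le)
    then show ?thesis using g(1) assms(1,2) e by (intro bexI[of _ g]) auto
  qed
  then show ?thesis
    using assms(2) by (auto simp: mtopology_of_def metric_closure_of)
qed

text \<open>This is Baire's theorem; the space of maps is complete because \<open>[0,1]\<close> is.\<close>

lemma typicalI:
  assumes "countable \<G>" "\<G> \<noteq> {}"
    and op: "\<And>U. U \<in> \<G> \<Longrightarrow> openin (mtopology_of C01_metric) U"
    and de: "\<And>U. U \<in> \<G> \<Longrightarrow> mtopology_of C01_metric closure_of U = C01"
    and P: "\<And>f. f \<in> C01 \<Longrightarrow> f \<in> \<Inter>\<G> \<Longrightarrow> P f"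
  shows "typical P"
proof -
  interpret Metric_space C01 "mdist C01_metric" by (rule Metric_space_mspace_mdist)
  interpret I: Metric_space "{0..1::real}" dist
    by (rule Met_TC.subspace) simp
  have sub: "submetric euclidean_metric {0..1::real} = metric ({0..1}, dist)"
    by (simp add: submetric_def)
  have "compactin I.mtopology {0..1}"
  proof -
    have "I.mtopology = top_of_set {0..1}"
      using mtopology_of_submetric[of "euclidean_metric :: real metric" "{0..1}"]
      by (simp add: sub mtopology_of_def)
    then show ?thesis by (simp add: compactin_subtopology)
  qed
  then have "I.mcomplete"
    using I.compact_space_imp_mcomplete[unfolded compact_space_def] by simp
  then have "mcomplete_of C01_metric"
    unfolding C01_metric_def sub using I.mcomplete_cfunspace[of "top_of_set {0..1}"]
    by (simp add: I.Self_def)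
  then have "mcomplete" by (simp add: mcomplete_of_def)
  then have "mtopology closure_of \<Inter>\<G> = C01"
    using op de assms(1) by (intro metric_Baire_category) (auto simp: mtopology_of_def)
  moreover have "gdelta_in mtopology (\<Inter>\<G>)"
  proof (rule gdelta_in_Inter[OF assms(1,2)])
    fix U assume "U \<in> \<G>"
    then show "gdelta_in mtopology U"
      by (rule open_imp_gdelta_in[OF op[unfolded mtopology_of_def]])
  qed
  moreover from calculation(2) have "\<Inter>\<G> \<subseteq> C01"
    using gdelta_in_subset by fastforce
  then have "\<forall>f\<in>\<Inter>\<G>. P f"
    using P by blast
  ultimately show ?thesis
    unfolding typical_def mtopology_of_def by blast
qed

text \<open>The boundary of an open set is nowhere dense. Hence a generic point that lies in the closure of an
open set \<open>W\<close> lies in \<open>W\<close> itself, which turns approximability of a property into the property.\<close>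

lemma open_dense_Un_exterior:
  fixes T :: "'a topology"
  assumes "openin T W"
  shows "openin T (W \<union> (topspace T - T closure_of W))"
    and "T closure_of (W \<union> (topspace T - T closure_of W)) = topspace T"
proof -
  show "openin T (W \<union> (topspace T - T closure_of W))"
    using assms by (intro openin_Un openin_diff) auto
  have "topspace T - T closure_of W \<subseteq> T closure_of (topspace T - T closure_of W)"
    by (rule closure_of_subset) auto
  then show "T closure_of (W \<union> (topspace T - T closure_of W)) = topspace T"
    unfolding closure_of_Un
    using closure_of_subset_topspace[of T W]
      closure_of_subset_topspace[of T "topspace T - T closure_of W"] by blast
qed

lemma C01_uniformly_continuous:
  assumes "f \<in> C01" "e > 0"
  obtains d where "d > 0" "\<And>x y. x \<in> {0..1} \<Longrightarrow> y \<in> {0..1} \<Longrightarrow> \<bar>x - y\<bar> < d \<Longrightarrow> \<bar>f x - f y\<bar> < e"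
proof -
  have "uniformly_continuous_on {0..1} f"
    using assms(1) by (intro compact_uniformly_continuous) (auto simp: C01_iff)
  then show ?thesis
    using assms(2) that unfolding uniformly_continuous_on_def dist_real_def by metis
qed

text \<open>A small perturbation can prescribe the values at finitely many points and even make the map constant
near each of them. Constancy is what creates traps, the freedom in the values is what creates
horseshoes. The points are treated one at a time, by interpolating between the map and the
prescribed constant with a tent function whose support avoids the other points.\<close>

lemma flatten_near_finite_set:
  fixes v :: "real \<Rightarrow> real"
  assumes "f \<in> C01" "finite X" "X \<subseteq> {0..1}" "e > 0"
    and "\<And>x. x \<in> X \<Longrightarrow> v x \<in> {0..1}" "\<And>x. x \<in> X \<Longrightarrow> \<bar>f x - v x\<bar> < e"
  shows "\<exists>g\<in>C01. (\<forall>x\<in>{0..1}. \<bar>f x - g x\<bar> < e) \<and>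
    (\<exists>d>0. \<forall>x\<in>X. \<forall>y\<in>{0..1}. \<bar>y - x\<bar> \<le> d \<longrightarrow> g y = v x)"
  using assms(2,3,5,6)
proof (induction X rule: finite_induct)
  case empty
  show ?case using assms(1,4) by (intro bexI[of _ f]) (auto intro: exI[of _ 1])
next
  case (insert x X)
  then obtain g d where g: "g \<in> C01" "\<And>y. y \<in> {0..1} \<Longrightarrow> \<bar>f y - g y\<bar> < e" and d: "d > 0"
    "\<And>x y. x \<in> X \<Longrightarrow> y \<in> {0..1} \<Longrightarrow> \<bar>y - x\<bar> \<le> d \<Longrightarrow> g y = v x"
    by (auto simp: subset_iff)
  have x: "x \<in> {0..1}" "v x \<in> {0..1}" "\<bar>f x - v x\<bar> < e" using insert.prems by auto
  obtain d1 where d1: "d1 > 0" "\<And>y. y \<in> {0..1} \<Longrightarrow> \<bar>x - y\<bar> < d1 \<Longrightarrow> \<bar>f x - f y\<bar> < e - \<bar>f x - v x\<bar>"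
  proof -
    have "e - \<bar>f x - v x\<bar> > 0" using x by simp
    from C01_uniformly_continuous[OF assms(1) this] x(1) that show ?thesis by metis
  qed
  obtain d2 where d2: "d2 > 0" "\<And>x'. x' \<in> X \<Longrightarrow> d2 \<le> \<bar>x - x'\<bar>"
    using finite_set_avoid[OF insert.hyps(1), of x] insert.hyps(2) by (auto simp: dist_real_def) metis
  define h where "h = min (d1 / 3) (d2 / 4)"
  have h: "h > 0" "2 * h < d1" "4 * h \<le> d2" using d1 d2 by (auto simp: h_def)
  define l where "l y = max 0 (min 1 (2 - \<bar>y - x\<bar> / h))" for y
  have l01: "0 \<le> l y" "l y \<le> 1" for y by (auto simp: l_def)
  have l1: "l y = 1" if "\<bar>y - x\<bar> \<le> h" for y
    using that h by (auto simp: l_def min_def max_def field_simps)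
  have l0: "l y = 0" if "\<bar>y - x\<bar> \<ge> 2 * h" for y
    using that h by (auto simp: l_def min_def max_def field_simps)
  define G where "G = restrict (\<lambda>y. (1 - l y) * g y + l y * v x) {0..1}"
  have "G \<in> C01"
    unfolding C01_iff
  proof (intro conjI)
    show "G \<in> {0..1} \<rightarrow> {0..1}"
    proof
      fix y :: real assume y: "y \<in> {0..1}"
      then have "g y \<in> {0..1}" using g(1) by (auto simp: C01_iff)
      then have "(1 - l y) * g y + l y * v x \<in> {0..1}"
        using x(2) l01[of y] convex_bound_le[of "g y" 1 "v x" "1 - l y" "l y"] by auto
      then show "G y \<in> {0..1}" using y by (simp add: G_def)
    qed
    have "continuous_on {0..1} g" using g(1) by (simp add: C01_iff)
    then have "continuous_on {0..1} (\<lambda>y. (1 - l y) * g y + l y * v x)"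
      unfolding l_def using h by (intro continuous_intros) auto
    then show "continuous_on {0..1} G"
      by (rule continuous_on_eq) (simp add: G_def)
  qed (simp add: G_def)
  moreover have "\<bar>f y - G y\<bar> < e" if y: "y \<in> {0..1}" for y
  proof (cases "\<bar>y - x\<bar> < 2 * h")
    case True
    then have "\<bar>f x - f y\<bar> < e - \<bar>f x - v x\<bar>" using h y by (intro d1(2)) auto
    then have 1: "\<bar>f y - v x\<bar> < e" by linarith
    have "f y - G y = (1 - l y) * (f y - g y) + l y * (f y - v x)"
      using y by (simp add: G_def algebra_simps)
    also have "\<bar>\<dots>\<bar> \<le> (1 - l y) * \<bar>f y - g y\<bar> + l y * \<bar>f y - v x\<bar>"
      using l01[of y] by (intro order_trans[OF abs_triangle_ineq]) (simp add: abs_mult)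
    also have "\<dots> < e"
      using l01[of y] 1 g(2)[OF y] by (intro convex_bound_lt) auto
    finally show ?thesis .
  next
    case False
    then show ?thesis using g(2)[OF y] y l0[of y] by (simp add: G_def)
  qed
  moreover have "G y = v x'" if "x' \<in> insert x X" "y \<in> {0..1}" "\<bar>y - x'\<bar> \<le> min d h" for x' y
  proof (cases "x' = x")
    case True
    then show ?thesis using that l1[of y] by (simp add: G_def)
  next
    case False
    then have "x' \<in> X" using that by simp
    with d2(2)[of x'] have "\<bar>y - x\<bar> \<ge> 2 * h" using that(3) h(1,3) by linarith
    then show ?thesis using that d(2)[of x' y] \<open>x' \<in> X\<close> l0[of y] by (simp add: G_def)
  qed
  ultimately show ?case using d(1) h(1)
    by (intro bexI[of _ G] conjI exI[of _ "min d h"]) auto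
qed

section \<open>Traps around periodic orbits\<close>

text \<open>The centres in \<open>xs\<close> are visited cyclically: the \<open>r\<close>-neighbourhood of each is mapped into the
\<open>s\<close>-neighbourhood of the next. With \<open>s < r\<close> there is a margin, so that this survives perturbation.
The centres need not be distinct.\<close>

definition cyclic_trap :: "(real \<Rightarrow> real) \<Rightarrow> real list \<Rightarrow> real \<Rightarrow> real \<Rightarrow> bool" where
  "cyclic_trap f xs r s \<longleftrightarrow>
     (\<forall>i<length xs. \<forall>y\<in>{0..1}. \<bar>y - xs ! i\<bar> \<le> r \<longrightarrow> \<bar>f y - xs ! (Suc i mod length xs)\<bar> \<le> s)"

lemma cyclic_trap_orbit:
  assumes f: "f \<in> C01" and trap: "cyclic_trap f xs r s" "s \<le> r" "xs \<noteq> []"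
    and y: "y \<in> {0..1}" "\<bar>y - xs ! 0\<bar> \<le> r"
  shows "\<bar>(f ^^ j) y - xs ! (j mod length xs)\<bar> \<le> r"
proof (induction j)
  case 0
  show ?case using y by simp
next
  case (Suc j)
  have "j mod length xs < length xs" using trap(3) by simp
  then have "\<bar>f ((f ^^ j) y) - xs ! (Suc (j mod length xs) mod length xs)\<bar> \<le> s"
    using trap(1) Suc C01_funpow[OF f y(1), of j] unfolding cyclic_trap_def by blast
  then show ?case using trap(2) by (simp add: mod_Suc_eq)
qed

text \<open>Rational approximations of the centres serve as index, because only countably many conditions may be
imposed on a generic map. The actual centres stay real: they have to follow the given
periodic orbit exactly.\<close>

definition trapping_maps :: "rat list \<Rightarrow> nat \<Rightarrow> (real \<Rightarrow> real) set" where
  "trapping_maps qs k = {f \<in> C01. \<exists>xs r s. length xs = length qs \<and> set xs \<subseteq> {0..1} \<and>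
     (\<forall>i<length qs. \<bar>xs ! i - of_rat (qs ! i)\<bar> < 1 / Suc k) \<and>
     0 \<le> s \<and> s < r \<and> r < 1 / Suc k \<and> cyclic_trap f xs r s}"

lemma openin_trapping_maps: "openin (mtopology_of C01_metric) (trapping_maps qs k)"
proof (rule openin_C01I)
  fix f assume "f \<in> trapping_maps qs k"
  then obtain xs r s where xs: "length xs = length qs" "set xs \<subseteq> {0..1}"
     "\<forall>i<length qs. \<bar>xs ! i - of_rat (qs ! i)\<bar> < 1 / Suc k"
     "0 \<le> s" "s < r" "r < 1 / Suc k" and trap: "cyclic_trap f xs r s"
    by (auto simp: trapping_maps_def)
  have "g \<in> trapping_maps qs k"
    if g: "g \<in> C01" "\<forall>x\<in>{0..1}. \<bar>f x - g x\<bar> < (r - s) / 2" for g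
  proof -
    have "cyclic_trap g xs r ((r + s) / 2)"
      unfolding cyclic_trap_def
    proof (intro allI impI ballI)
      fix i y assume "i < length xs" and y: "y \<in> {0..1}" and "\<bar>y - xs ! i\<bar> \<le> r"
      then have "\<bar>f y - xs ! (Suc i mod length xs)\<bar> \<le> s"
        using trap by (simp add: cyclic_trap_def)
      moreover have "\<bar>f y - g y\<bar> < (r - s) / 2" using g(2) y by blast
      ultimately show "\<bar>g y - xs ! (Suc i mod length xs)\<bar> \<le> (r + s) / 2"
        unfolding diff_divide_distrib add_divide_distrib by linarith
    qed
    then show ?thesis
      unfolding trapping_maps_def using xs g(1)
      by (intro CollectI conjI exI[of _ xs] exI[of _ r] exI[of _ "(r + s) / 2"]) auto
  qed
  then show "\<exists>e>0. \<forall>g\<in>C01. (\<forall>x\<in>{0..1}. \<bar>f x - g x\<bar> < e) \<longrightarrow> g \<in> trapping_maps qs k"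
    using xs(5) by (intro exI[of _ "(r - s) / 2"]) auto
qed (auto simp: trapping_maps_def)

text \<open>Flattening the map at the points of a periodic orbit keeps the orbit and makes the map collapse a
neighbourhood of each point to the next one, which is a trap with \<open>s = 0\<close>.\<close>

lemma periodic_orbit_in_closure_trapping_maps:
  assumes f: "f \<in> C01" and z: "z \<in> {0..1}" "(f ^^ p) z = z" and p: "p > 0"
    and qs: "length qs = p" "\<And>i. i < p \<Longrightarrow> \<bar>(f ^^ i) z - of_rat (qs ! i)\<bar> < 1 / Suc k"
  shows "f \<in> mtopology_of C01_metric closure_of trapping_maps qs k"
proof (rule C01_in_closureI[OF _ f])
  show "trapping_maps qs k \<subseteq> C01" by (auto simp: trapping_maps_def)
  fix e :: real assume e: "e > 0"
  define xs where "xs = map (\<lambda>i. (f ^^ i) z) [0..<p]"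
  have xs: "length xs = p" "set xs \<subseteq> {0..1}" "\<And>i. i < p \<Longrightarrow> xs ! i = (f ^^ i) z"
    using C01_funpow[OF f z(1)] by (auto simp: xs_def)
  have "\<exists>g\<in>C01. (\<forall>x\<in>{0..1}. \<bar>f x - g x\<bar> < e) \<and>
    (\<exists>d>0. \<forall>x\<in>set xs. \<forall>y\<in>{0..1}. \<bar>y - x\<bar> \<le> d \<longrightarrow> g y = f x)"
    using xs(2) e f by (intro flatten_near_finite_set[OF f]) (auto simp: C01_iff Pi_iff)
  then obtain g d where g: "g \<in> C01" "\<forall>x\<in>{0..1}. \<bar>f x - g x\<bar> < e" and d: "d > 0"
    "\<And>x y. x \<in> set xs \<Longrightarrow> y \<in> {0..1} \<Longrightarrow> \<bar>y - x\<bar> \<le> d \<Longrightarrow> g y = f x"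
    by blast
  define r where "r = min d (1 / (2 * Suc k))"
  have r: "0 < r" "r \<le> d" "r < 1 / Suc k"
    using d(1) by (auto simp: r_def min_def field_simps)
  have "cyclic_trap g xs r 0"
    unfolding cyclic_trap_def
  proof (intro allI impI ballI)
    fix i y assume i: "i < length xs" and y: "y \<in> {0..1}" "\<bar>y - xs ! i\<bar> \<le> r"
    have "g y = f (xs ! i)" using i y r by (intro d(2)) auto
    also have "\<dots> = (f ^^ Suc i) z" using i xs by simp
    also have "\<dots> = xs ! (Suc i mod length xs)"
      using funpow_mod_eq[OF z(2), of "Suc i"] xs p by simp
    finally show "\<bar>g y - xs ! (Suc i mod length xs)\<bar> \<le> 0" by simp
  qed
  then have "g \<in> trapping_maps qs k"
    unfolding trapping_maps_def using xs g(1) r qs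
    by (intro CollectI conjI exI[of _ xs] exI[of _ r] exI[of _ 0]) auto
  then show "\<exists>g\<in>trapping_maps qs k. \<forall>x\<in>{0..1}. \<bar>f x - g x\<bar> < e"
    using g(2) by blast
qed

text \<open>A whole interval of initial points, hence a set of positive Lebesgue measure, stays close to the
orbit of \<open>z\<close> for all times. The point \<open>z\<close> itself may lie outside the interval, so this is weaker
than Lyapunov stability.\<close>

definition shadowed :: "(real \<Rightarrow> real) \<Rightarrow> real \<Rightarrow> bool" where
  "shadowed f z \<longleftrightarrow>
     (\<forall>e>0. \<exists>a b. 0 \<le> a \<and> a < b \<and> b \<le> 1 \<and> (\<forall>y\<in>{a..b}. \<forall>j. \<bar>(f ^^ j) y - (f ^^ j) z\<bar> < e))"

text \<open>By the density of traps, the map lies in the closure of every set of trapping maps whose index is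
close to the periodic orbit, and by genericity in that set. All points near the first centre of the
resulting trap follow its centres, which follow the periodic orbit.\<close>

lemma periodic_shadowed:
  assumes f: "f \<in> C01"
    and generic: "\<And>qs k. f \<in> trapping_maps qs k \<or>
          f \<notin> mtopology_of C01_metric closure_of trapping_maps qs k"
    and z: "z \<in> {0..1}" "(f ^^ p) z = z" and p: "p > 0"
  shows "shadowed f z"
  unfolding shadowed_def
proof (intro allI impI)
  fix e :: real assume "e > 0"
  then obtain k where k: "inverse (of_nat (Suc k)) < e / 3"
    using reals_Archimedean[of "e / 3"] by auto
  have "\<exists>q. \<bar>(f ^^ i) z - of_rat q\<bar> < 1 / Suc k" for i
  proof -
    have "(f ^^ i) z - 1 / Suc k < (f ^^ i) z + 1 / Suc k"
      by (simp add: add_pos_pos)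
    then obtain q where "(f ^^ i) z - 1 / Suc k < of_rat q" "of_rat q < (f ^^ i) z + 1 / Suc k"
      using of_rat_dense by blast
    then show ?thesis by (intro exI[of _ q]) linarith
  qed
  then obtain q where q: "\<And>i. \<bar>(f ^^ i) z - of_rat (q i)\<bar> < 1 / Suc k" by metis
  define qs where "qs = map q [0..<p]"
  have qs: "length qs = p" "\<And>i. i < p \<Longrightarrow> \<bar>(f ^^ i) z - of_rat (qs ! i)\<bar> < 1 / Suc k"
    using q by (auto simp: qs_def)
  from periodic_orbit_in_closure_trapping_maps[OF f z p qs] generic
  have "f \<in> trapping_maps qs k" by blast
  then obtain xs r s where xs: "length xs = p" "set xs \<subseteq> {0..1}"
     "\<And>i. i < p \<Longrightarrow> \<bar>xs ! i - of_rat (qs ! i)\<bar> < 1 / Suc k"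
     "0 \<le> s" "s < r" "r < 1 / Suc k" and trap: "cyclic_trap f xs r s"
    using qs(1) by (auto simp: trapping_maps_def)
  have x0: "xs ! 0 \<in> {0..1}" and ne: "xs \<noteq> []" using xs(1,2) p by (auto simp: subset_iff)
  define a where "a = max 0 (xs ! 0 - r)"
  define b where "b = min 1 (xs ! 0 + r)"
  have ab: "0 \<le> a" "a < b" "b \<le> 1" using x0 xs(4,5) by (auto simp: a_def b_def)
  have "\<bar>(f ^^ j) y - (f ^^ j) z\<bar> < e" if y: "y \<in> {a..b}" for y j
  proof -
    have "y \<in> {0..1}" "\<bar>y - xs ! 0\<bar> \<le> r" using y ab by (auto simp: a_def b_def)
    then have "\<bar>(f ^^ j) y - xs ! (j mod p)\<bar> \<le> r"
      using cyclic_trap_orbit[OF f trap _ ne] xs(1,5) by simp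
    moreover have "j mod p < p" using p by simp
    note xs(3)[OF this] qs(2)[OF this]
    moreover have "(f ^^ (j mod p)) z = (f ^^ j) z" by (rule funpow_mod_eq[OF z(2)])
    moreover have "1 / real (Suc k) < e / 3" using k by (simp add: inverse_eq_divide)
    ultimately show ?thesis using xs(6) by linarith
  qed
  then show "\<exists>a b. 0 \<le> a \<and> a < b \<and> b \<le> 1 \<and> (\<forall>y\<in>{a..b}. \<forall>j. \<bar>(f ^^ j) y - (f ^^ j) z\<bar> < e)"
    using ab by blast
qed

section \<open>Horseshoes and their periodic orbits\<close>

lemma interval_fixed_point:
  fixes F :: "real \<Rightarrow> real"
  assumes "continuous_on {u..v} F" "u \<le> v"
    and "F u \<le> u \<and> v \<le> F v \<or> u \<le> F u \<and> F v \<le> v"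
  shows "\<exists>x\<in>{u..v}. F x = x"
proof -
  have c: "continuous_on {u..v} (\<lambda>x. F x - x)" using assms(1) by (intro continuous_intros)
  from assms(3) show ?thesis
  proof
    assume "F u \<le> u \<and> v \<le> F v"
    then show ?thesis using IVT'[of "\<lambda>x. F x - x" u 0 v] c assms(2) by auto
  next
    assume "u \<le> F u \<and> F v \<le> v"
    then show ?thesis using IVT2'[of "\<lambda>x. F x - x" v 0 u] c assms(2) by auto
  qed
qed

lemma crossing_subinterval_increasing:
  fixes F :: "real \<Rightarrow> real"
  assumes cont: "continuous_on {u..v} F" and "u \<le> v" and "F u \<le> l" "l < h" "h \<le> F v"
  shows "\<exists>u' v'. u \<le> u' \<and> u' \<le> v' \<and> v' \<le> v \<and> F u' = l \<and> F v' = h \<and> (\<forall>t\<in>{u'..v'}. F t \<in> {l..h})"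
proof -
  have level: "compact {t \<in> {u..w}. F t = c}" if "w \<le> v" for w c
  proof -
    have "continuous_on {u..w} F" using cont that by (rule_tac continuous_on_subset) auto
    then have "closed ({u..w} \<inter> F -` {c})" by (intro continuous_closed_preimage) auto
    then have "compact ({u..w} \<inter> ({u..w} \<inter> F -` {c}))" by (intro compact_Int_closed) auto
    moreover have "{u..w} \<inter> ({u..w} \<inter> F -` {c}) = {t \<in> {u..w}. F t = c}" by auto
    ultimately show ?thesis by simp
  qed
  have hit: "\<exists>t\<in>{x..y}. F t = c" if "u \<le> x" "x \<le> y" "y \<le> v" "F x \<le> c" "c \<le> F y" for x y c
    using IVT'[of F x c y] that continuous_on_subset[OF cont, of "{x..y}"] by auto
  \<comment> \<open>the first time at level \<open>h\<close>\<close>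
  obtain v' where v': "v' \<in> {u..v}" "F v' = h" "\<And>t. t \<in> {u..v} \<Longrightarrow> F t = h \<Longrightarrow> v' \<le> t"
  proof -
    have "{t \<in> {u..v}. F t = h} \<noteq> {}" using hit[of u v h] assms by auto
    from compact_attains_inf[OF level[OF order_refl] this] that show ?thesis by blast
  qed
  have "F u < h" using assms by simp
  \<comment> \<open>the last time before \<open>v'\<close> at level \<open>l\<close>\<close>
  obtain u' where u': "u' \<in> {u..v'}" "F u' = l" "\<And>t. t \<in> {u..v'} \<Longrightarrow> F t = l \<Longrightarrow> t \<le> u'"
  proof -
    have "{t \<in> {u..v'}. F t = l} \<noteq> {}" "v' \<le> v" using hit[of u v' l] assms v' by auto
    from compact_attains_sup[OF level[OF this(2)] this(1)] that show ?thesis by blast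
  qed
  have "F t \<in> {l..h}" if t: "t \<in> {u'..v'}" for t
  proof -
    have "F t \<le> h"
    proof (rule ccontr)
      assume "\<not> F t \<le> h"
      then obtain s where "s \<in> {u..t}" "F s = h"
        using hit[of u t h] t u' v' assms by auto
      moreover from this have "v' \<le> s" using v' t u' by auto
      ultimately have "s = t" using t by auto
      with \<open>\<not> F t \<le> h\<close> \<open>F s = h\<close> show False by simp
    qed
    moreover have "l \<le> F t"
    proof (rule ccontr)
      assume "\<not> l \<le> F t"
      then obtain s where "s \<in> {t..v'}" "F s = l"
        using hit[of t v' l] t u' v' assms by auto
      moreover from this have "s \<le> u'" using u' t by auto
      ultimately have "s = t" using t by auto
      with \<open>\<not> l \<le> F t\<close> \<open>F s = l\<close> show False by simp
    qed
    ultimately show ?thesis by simp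
  qed
  then show ?thesis using u' v' by (intro exI[of _ u'] exI[of _ v']) auto
qed

lemma crossing_subinterval:
  fixes F :: "real \<Rightarrow> real"
  assumes cont: "continuous_on {u..v} F" and "u \<le> v" "l < h"
    and "F u \<le> l \<and> h \<le> F v \<or> h \<le> F u \<and> F v \<le> l"
  shows "\<exists>u' v'. u \<le> u' \<and> u' \<le> v' \<and> v' \<le> v \<and>
    (F u' = l \<and> F v' = h \<or> F u' = h \<and> F v' = l) \<and> (\<forall>t\<in>{u'..v'}. F t \<in> {l..h})"
  using assms(4)
proof
  assume "F u \<le> l \<and> h \<le> F v"
  then show ?thesis
    using crossing_subinterval_increasing[OF cont assms(2), of l h] assms(3) by blast
next
  assume "h \<le> F u \<and> F v \<le> l"
  then obtain u' v' where uv: "u \<le> u'" "u' \<le> v'" "v' \<le> v" "- F u' = - h" "- F v' = - l"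
      "\<And>t. t \<in> {u'..v'} \<Longrightarrow> - F t \<in> {-h..-l}"
    using crossing_subinterval_increasing[of u v "\<lambda>t. - F t" "-h" "-l"] assms(2,3)
      continuous_on_minus[OF cont] by auto
  then show ?thesis by (intro exI[of _ u'] exI[of _ v']) auto
qed

text \<open>Each of the disjoint intervals \<open>[a,b]\<close> and \<open>[c,d]\<close> is stretched across \<open>[a,d]\<close>. The inequalities are
strict, which makes the condition open, and they concern four values only, which makes it easy to
create.\<close>

definition horseshoe :: "(real \<Rightarrow> real) \<Rightarrow> real \<Rightarrow> real \<Rightarrow> real \<Rightarrow> real \<Rightarrow> bool" where
  "horseshoe f a b c d \<longleftrightarrow> 0 \<le> a \<and> a < b \<and> b < c \<and> c < d \<and> d \<le> 1 \<and>
     f a < a \<and> d < f b \<and> d < f c \<and> f d < a"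

definition horseshoe_maps :: "nat \<Rightarrow> (real \<Rightarrow> real) set" where
  "horseshoe_maps n = {f \<in> C01. \<exists>a b c d. horseshoe f a b c d \<and> d - a < 1 / Suc n}"

lemma openin_horseshoe_maps: "openin (mtopology_of C01_metric) (horseshoe_maps n)"
proof (rule openin_C01I)
  fix f assume "f \<in> horseshoe_maps n"
  then obtain a b c d where h: "horseshoe f a b c d" "d - a < 1 / Suc n"
    by (auto simp: horseshoe_maps_def)
  define e where "e = min (min (a - f a) (f b - d)) (min (f c - d) (a - f d))"
  have e: "e > 0" "e \<le> a - f a" "e \<le> f b - d" "e \<le> f c - d" "e \<le> a - f d"
    using h(1) by (auto simp: e_def horseshoe_def)
  have "g \<in> horseshoe_maps n" if g: "g \<in> C01" "\<forall>x\<in>{0..1}. \<bar>f x - g x\<bar> < e" for g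
  proof -
    have "\<bar>f x - g x\<bar> < e" if "x \<in> {a, b, c, d}" for x
      using g(2) h(1) that by (auto simp: horseshoe_def)
    from this[of a] this[of b] this[of c] this[of d] have "horseshoe g a b c d"
      using h(1) e unfolding horseshoe_def by auto
    then show ?thesis using g(1) h(2) unfolding horseshoe_maps_def by blast
  qed
  with e(1) show "\<exists>e>0. \<forall>g\<in>C01. (\<forall>x\<in>{0..1}. \<bar>f x - g x\<bar> < e) \<longrightarrow> g \<in> horseshoe_maps n"
    by blast
qed (auto simp: horseshoe_maps_def)

text \<open>Near a fixed point \<open>q\<close> all arguments and values are close to \<open>q\<close>, so a small perturbation can
prescribe any four values that are close to \<open>q\<close>.\<close>

lemma dense_horseshoe_maps: "mtopology_of C01_metric closure_of horseshoe_maps n = C01"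
proof
  show "mtopology_of C01_metric closure_of horseshoe_maps n \<subseteq> C01"
    using closure_of_subset_topspace[of "mtopology_of C01_metric"] by simp
  show "C01 \<subseteq> mtopology_of C01_metric closure_of horseshoe_maps n"
  proof
    fix f assume f: "f \<in> C01"
    show "f \<in> mtopology_of C01_metric closure_of horseshoe_maps n"
    proof (rule C01_in_closureI[OF _ f])
      show "horseshoe_maps n \<subseteq> C01" by (auto simp: horseshoe_maps_def)
      fix e :: real assume e: "e > 0"
      obtain q where q: "q \<in> {0..1}" "f q = q"
        using interval_fixed_point[of 0 1 f] f by (auto simp: C01_iff Pi_iff)
      obtain \<delta> where \<delta>: "\<delta> > 0"
        "\<And>x y. x \<in> {0..1} \<Longrightarrow> y \<in> {0..1} \<Longrightarrow> \<bar>x - y\<bar> < \<delta> \<Longrightarrow> \<bar>f x - f y\<bar> < e / 2"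
        using C01_uniformly_continuous[OF f half_gt_zero[OF e]] by blast
      define R where "R = 1 / real (Suc n)"
      have R: "R > 0" by (simp add: R_def)
      define \<eta> where "\<eta> = min (\<delta> / 2) (min (e / 2) (R / 2))"
      have \<eta>: "0 < \<eta>" "\<eta> < \<delta>" "\<eta> \<le> e / 2" "2 * \<eta> \<le> R"
        using \<delta>(1) e R unfolding \<eta>_def by linarith+
      define l where "l = max 0 (q - \<eta>)"
      define u where "u = min 1 (q + \<eta>)"
      have lu: "0 \<le> l" "l < u" "u \<le> 1" "q - \<eta> \<le> l" "u \<le> q + \<eta>" "l \<le> q" "q \<le> u"
        using q \<eta>(1) by (simp_all add: l_def u_def)
      define t where "t = (u - l) / 5"
      have t: "0 < t" "l + 5 * t = u" using lu(2) by (simp_all add: t_def field_simps)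
      define a where "a = l + t"
      define b where "b = l + 2 * t"
      define c where "c = l + 3 * t"
      define d where "d = l + 4 * t"
      have abcd: "l < a" "a < b" "b < c" "c < d" "d < u"
        using t unfolding a_def b_def c_def d_def by simp_all
      define v where "v x = (if x = a \<or> x = d then l else u)" for x
      have "\<exists>g\<in>C01. (\<forall>x\<in>{0..1}. \<bar>f x - g x\<bar> < e) \<and>
        (\<exists>r>0. \<forall>x\<in>{a, b, c, d}. \<forall>y\<in>{0..1}. \<bar>y - x\<bar> \<le> r \<longrightarrow> g y = v x)"
      proof (rule flatten_near_finite_set[OF f _ _ e])
        fix x assume x: "x \<in> {a, b, c, d}"
        show "v x \<in> {0..1}" using lu by (auto simp: v_def)
        have "l < x" "x < u" using x abcd by auto
        then have "\<bar>f x - f q\<bar> < e / 2" using lu(1,3,4,5) q(1) \<eta>(2) by (intro \<delta>(2)) auto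
        moreover have "\<bar>q - v x\<bar> \<le> e / 2" using lu(4-7) \<eta>(3) by (simp add: v_def)
        ultimately show "\<bar>f x - v x\<bar> < e" using q(2) field_sum_of_halves[of e] by linarith
      qed (use abcd lu in auto)
      then obtain g r where g: "g \<in> C01" "\<forall>x\<in>{0..1}. \<bar>f x - g x\<bar> < e" and r: "r > 0"
        "\<forall>x\<in>{a, b, c, d}. \<forall>y\<in>{0..1}. \<bar>y - x\<bar> \<le> r \<longrightarrow> g y = v x" by blast
      have "g x = v x" if "x \<in> {a, b, c, d}" for x
        using r that abcd lu by auto
      then have "horseshoe g a b c d"
        using abcd lu unfolding horseshoe_def by (auto simp: v_def)
      moreover have "d - a < 1 / Suc n" using abcd(1,5) lu(4,5) \<eta>(4) unfolding R_def by linarith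
      ultimately have "g \<in> horseshoe_maps n" using g(1) unfolding horseshoe_maps_def by blast
      then show "\<exists>g\<in>horseshoe_maps n. \<forall>x\<in>{0..1}. \<bar>f x - g x\<bar> < e" using g(2) by blast
    qed
  qed
qed

lemma continuous_on_funpow:
  assumes "f \<in> C01"
  shows "continuous_on {0..1} (f ^^ n)"
proof (induction n)
  case (Suc n)
  have "(f ^^ n) ` {0..1} \<subseteq> {0..1}" using C01_funpow[OF assms] by auto
  then have "continuous_on {0..1} (f \<circ> f ^^ n)"
    using assms Suc continuous_on_subset[of "{0..1}" f] by (intro continuous_on_compose) (auto simp: C01_iff)
  then show ?case by simp
qed (simp add: continuous_on_id)

text \<open>There are nested intervals of points that follow the first \<open>p\<close> symbols and are stretched across
\<open>[a,d]\<close> by \<open>f\<^sup>p\<close>; the next symbol cuts out a subinterval by the crossing lemma. At stage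
\<open>p\<close> the interval lies in \<open>[a,d]\<close> and its image covers \<open>[a,d]\<close>, which gives a fixed point of \<open>f\<^sup>p\<close>.\<close>

lemma horseshoe_periodic_itinerary:
  fixes \<sigma> :: "nat \<Rightarrow> bool"
  assumes f: "f \<in> C01" and h: "horseshoe f a b c d"
  shows "\<exists>z\<in>{a..d}. (f ^^ p) z = z \<and> (\<forall>i<p. (f ^^ i) z \<in> (if \<sigma> i then {c..d} else {a..b}))"
proof -
  have "\<exists>u v. a \<le> u \<and> u \<le> v \<and> v \<le> d \<and>
    (\<forall>i<p. \<forall>x\<in>{u..v}. (f ^^ i) x \<in> (if \<sigma> i then {c..d} else {a..b})) \<and>
    ((f ^^ p) u \<le> a \<and> d \<le> (f ^^ p) v \<or> d \<le> (f ^^ p) u \<and> (f ^^ p) v \<le> a)"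
  proof (induction p)
    case 0
    show ?case using h by (intro exI[of _ a] exI[of _ d]) (auto simp: horseshoe_def)
  next
    case (Suc p)
    then obtain u v where uv: "a \<le> u" "u \<le> v" "v \<le> d"
      "\<And>i x. i < p \<Longrightarrow> x \<in> {u..v} \<Longrightarrow> (f ^^ i) x \<in> (if \<sigma> i then {c..d} else {a..b})"
      and ends: "(f ^^ p) u \<le> a \<and> d \<le> (f ^^ p) v \<or> d \<le> (f ^^ p) u \<and> (f ^^ p) v \<le> a"
      by blast
    define l where "l = (if \<sigma> p then c else a)"
    define m where "m = (if \<sigma> p then d else b)"
    have lm: "a \<le> l" "l < m" "m \<le> d" "{l..m} = (if \<sigma> p then {c..d} else {a..b})"
      using h by (auto simp: l_def m_def horseshoe_def)
    have "continuous_on {u..v} (f ^^ p)"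
      using h uv by (intro continuous_on_subset[OF continuous_on_funpow[OF f]]) (auto simp: horseshoe_def)
    moreover have "(f ^^ p) u \<le> l \<and> m \<le> (f ^^ p) v \<or> m \<le> (f ^^ p) u \<and> (f ^^ p) v \<le> l"
      using ends lm by linarith
    ultimately obtain u' v' where u'v': "u \<le> u'" "u' \<le> v'" "v' \<le> v"
      "(f ^^ p) u' = l \<and> (f ^^ p) v' = m \<or> (f ^^ p) u' = m \<and> (f ^^ p) v' = l"
      "\<And>t. t \<in> {u'..v'} \<Longrightarrow> (f ^^ p) t \<in> {l..m}"
      using crossing_subinterval[of u v "f ^^ p" l m] uv(2) lm(2) by blast
    have "f l < a \<and> d < f m \<or> d < f l \<and> f m < a"
      using h by (auto simp: l_def m_def horseshoe_def)
    then have "(f ^^ Suc p) u' \<le> a \<and> d \<le> (f ^^ Suc p) v' \<or> d \<le> (f ^^ Suc p) u' \<and> (f ^^ Suc p) v' \<le> a"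
      using u'v'(4) by auto
    moreover have "\<forall>i<Suc p. \<forall>x\<in>{u'..v'}. (f ^^ i) x \<in> (if \<sigma> i then {c..d} else {a..b})"
    proof (intro allI impI ballI)
      fix i x assume i: "i < Suc p" and x: "x \<in> {u'..v'}"
      show "(f ^^ i) x \<in> (if \<sigma> i then {c..d} else {a..b})"
      proof (cases "i = p")
        case True
        then show ?thesis using u'v'(5)[OF x] lm(4) by simp
      next
        case False
        then show ?thesis using i x u'v' by (intro uv(4)) auto
      qed
    qed
    ultimately show ?case using uv u'v' by (intro exI[of _ u'] exI[of _ v']) auto
  qed
  then obtain u v where uv: "a \<le> u" "u \<le> v" "v \<le> d"
      "\<And>i x. i < p \<Longrightarrow> x \<in> {u..v} \<Longrightarrow> (f ^^ i) x \<in> (if \<sigma> i then {c..d} else {a..b})"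
      and ends: "(f ^^ p) u \<le> a \<and> d \<le> (f ^^ p) v \<or> d \<le> (f ^^ p) u \<and> (f ^^ p) v \<le> a"
    by blast
  have "continuous_on {u..v} (f ^^ p)"
    using h uv by (intro continuous_on_subset[OF continuous_on_funpow[OF f]]) (auto simp: horseshoe_def)
  then have "\<exists>z\<in>{u..v}. (f ^^ p) z = z"
    using uv ends by (intro interval_fixed_point) auto
  then obtain z where "z \<in> {u..v}" "(f ^^ p) z = z" by blast
  then show ?thesis using uv by (intro bexI[of _ z]) auto
qed

section \<open>Invariant measures and weak-star limits\<close>

lemma C01_compose:
  assumes "f \<in> C01" "g \<in> C01"
  shows "restrict (g \<circ> f) {0..1} \<in> C01"
proof -
  have "f ` {0..1} \<subseteq> {0..1}" using assms(1) by (auto simp: C01_iff)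
  then have "continuous_on {0..1} (g \<circ> f)"
    using assms continuous_on_subset[of "{0..1}" g "f ` {0..1}"]
    by (intro continuous_on_compose) (auto simp: C01_iff)
  then have "continuous_on {0..1} (restrict (g \<circ> f) {0..1})"
    by (rule continuous_on_eq) simp
  then show ?thesis using assms by (auto simp: C01_iff Pi_iff)
qed

lemma measurable_C01_borel01: "f \<in> C01 \<Longrightarrow> f \<in> borel01 \<rightarrow>\<^sub>M borel01"
  using C01_measurable[of f] unfolding borel01_def
  by (intro measurable_restrict_space2) (auto simp: C01_iff space_restrict_space)

lemma measurable_prob01: "\<mu> \<in> prob01 \<Longrightarrow> f \<in> borel01 \<rightarrow>\<^sub>M N \<Longrightarrow> f \<in> \<mu> \<rightarrow>\<^sub>M N"
  by (simp add: prob01_def cong: measurable_cong_sets)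

lemma prob01_distr:
  assumes "\<mu> \<in> prob01" "f \<in> C01"
  shows "distr \<mu> borel01 f \<in> prob01"
  using assms measurable_prob01[OF assms(1) measurable_C01_borel01[OF assms(2)]]
  by (auto simp: prob01_def intro: prob_space.prob_space_distr)

lemma integral_C01_compose:
  assumes "\<mu> \<in> prob01" "f \<in> C01" "g \<in> C01"
  shows "integral\<^sup>L \<mu> (restrict (g \<circ> f) {0..1}) = integral\<^sup>L (distr \<mu> borel01 f) g"
proof -
  have "integral\<^sup>L (distr \<mu> borel01 f) g = (\<integral>x. g (f x) \<partial>\<mu>)"
    using measurable_prob01[OF assms(1) measurable_C01_borel01[OF assms(2)]] C01_measurable[OF assms(3)]
    by (rule integral_distr)
  also have "\<dots> = integral\<^sup>L \<mu> (restrict (g \<circ> f) {0..1})"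
    using prob01_space[OF assms(1)] by (intro Bochner_Integration.integral_cong) auto
  finally show ?thesis by simp
qed

text \<open>Invariance only has to be tested on continuous functions, because these separate measures.\<close>

lemma invariant_measuresI:
  assumes "\<mu> \<in> prob01" "f \<in> C01"
    and "\<And>g. g \<in> C01 \<Longrightarrow> integral\<^sup>L \<mu> (restrict (g \<circ> f) {0..1}) = integral\<^sup>L \<mu> g"
  shows "\<mu> \<in> invariant_measures f"
  using assms prob01_eqI[OF prob01_distr[OF assms(1,2)] assms(1)]
  by (simp add: invariant_measures_def integral_C01_compose)

lemma invariant_measures_limit:
  assumes "f \<in> C01" "\<And>n. \<nu> n \<in> invariant_measures f" "\<mu> \<in> prob01"
    and "\<And>g. g \<in> C01 \<Longrightarrow> (\<lambda>n. integral\<^sup>L (\<nu> n) g) \<longlonglongrightarrow> integral\<^sup>L \<mu> g"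
  shows "\<mu> \<in> invariant_measures f"
proof (rule invariant_measuresI[OF assms(3,1)])
  fix g assume g: "g \<in> C01"
  have "integral\<^sup>L (\<nu> n) (restrict (g \<circ> f) {0..1}) = integral\<^sup>L (\<nu> n) g" for n
    using assms(2)[of n] integral_C01_compose[OF _ assms(1) g, of "\<nu> n"]
    by (simp add: invariant_measures_def)
  then show "integral\<^sup>L \<mu> (restrict (g \<circ> f) {0..1}) = integral\<^sup>L \<mu> g"
    using assms(4)[OF g] assms(4)[OF C01_compose[OF assms(1) g]] by (auto intro: LIMSEQ_unique)
qed

text \<open>Helly's selection theorem, applied to the measures on the line, where tightness is trivial because
all of them live on \<open>[0,1]\<close>.\<close>

lemma prob01_sequentially_compact:
  assumes "\<And>n. \<mu> n \<in> prob01"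
  obtains r \<nu> where "strict_mono (r :: nat \<Rightarrow> nat)" "\<nu> \<in> prob01"
    "\<And>g. g \<in> C01 \<Longrightarrow> (\<lambda>k. integral\<^sup>L (\<mu> (r k)) g) \<longlonglongrightarrow> integral\<^sup>L \<nu> g"
proof -
  have id: "id \<in> \<mu> n \<rightarrow>\<^sub>M borel" for n
    by (rule measurable_prob01[OF assms]) (simp add: borel01_def id_def measurable_restrict_space1)
  define M where "M n = distr (\<mu> n) borel id" for n
  have M: "real_distribution (M n)" for n
  proof -
    interpret prob_space "\<mu> n" using assms[of n] by (simp add: prob01_def)
    show ?thesis using id[of n] by (simp add: M_def)
  qed
  have "tight M"
    unfolding tight_def
  proof (intro conjI allI impI)
    fix e :: real assume "e > 0"
    have "measure (M n) {-1<..1} = 1" for n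
    proof -
      interpret prob_space "\<mu> n" using assms[of n] by (simp add: prob01_def)
      have "id -` {-1<..1} \<inter> space (\<mu> n) = space (\<mu> n)"
        using prob01_space[OF assms, of n] by auto
      then show ?thesis using id[of n] by (simp add: M_def measure_distr prob_space)
    qed
    then show "\<exists>a b. a < b \<and> (\<forall>n. 1 - e < measure (M n) {a<..b})"
      using \<open>e > 0\<close> by (intro exI[of _ "-1"] exI[of _ 1]) simp
  qed (rule M)
  then obtain r N where r: "strict_mono (r :: nat \<Rightarrow> nat)" and N: "real_distribution N"
    and conv: "weak_conv_m (M \<circ> id \<circ> r) N"
    using tight_imp_convergent_subsubsequence[of M id] by (auto simp: strict_mono_id)
  interpret N: real_distribution N by (rule N)
  \<comment> \<open>retracting the line onto \<open>[0,1]\<close> moves the limit back without locating its support\<close>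
  define c :: "real \<Rightarrow> real" where "c x = max 0 (min 1 x)" for x
  have c01: "c x \<in> {0..1}" for x by (auto simp: c_def)
  have "c \<in> borel_measurable borel" unfolding c_def by measurable
  then have c_meas: "c \<in> N \<rightarrow>\<^sub>M borel01"
    unfolding borel01_def using c01 by (intro measurable_restrict_space2) auto
  define \<nu> where "\<nu> = distr N borel01 c"
  have "\<nu> \<in> prob01"
    using c_meas by (auto simp: \<nu>_def prob01_def intro: N.prob_space_distr)
  moreover have "(\<lambda>k. integral\<^sup>L (\<mu> (r k)) g) \<longlonglongrightarrow> integral\<^sup>L \<nu> g" if g: "g \<in> C01" for g
  proof -
    have cont: "continuous_on UNIV (\<lambda>x. g (c x))"
    proof (rule continuous_on_compose2[of "{0..1}" g])
      show "continuous_on UNIV c" unfolding c_def by (intro continuous_intros)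
    qed (use g c01 in \<open>auto simp: C01_iff\<close>)
    then have meas: "(\<lambda>x. g (c x)) \<in> borel_measurable borel"
      by (rule borel_measurable_continuous_onI)
    have "(\<lambda>k. integral\<^sup>L ((M \<circ> id \<circ> r) k) (\<lambda>x. g (c x))) \<longlonglongrightarrow> integral\<^sup>L N (\<lambda>x. g (c x))"
    proof (rule weak_conv_imp_integral_bdd_continuous_conv[OF _ N conv])
      show "isCont (\<lambda>x. g (c x)) x" for x
        using cont by (simp add: continuous_on_eq_continuous_at)
      show "norm (g (c x)) \<le> 1" for x
        using g c01[of x] by (auto simp: C01_iff Pi_iff)
    qed (use M in auto)
    moreover have "integral\<^sup>L ((M \<circ> id \<circ> r) k) (\<lambda>x. g (c x)) = integral\<^sup>L (\<mu> (r k)) g" for k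
    proof -
      have "integral\<^sup>L ((M \<circ> id \<circ> r) k) (\<lambda>x. g (c x)) = (\<integral>x. g (c (id x)) \<partial>\<mu> (r k))"
        unfolding o_def M_def id_def[symmetric]
        using integral_distr[OF id[of "r k"] meas] by (simp add: id_def)
      also have "\<dots> = integral\<^sup>L (\<mu> (r k)) g"
        using prob01_space[OF assms] by (intro Bochner_Integration.integral_cong) (auto simp: c_def)
      finally show ?thesis .
    qed
    moreover have "integral\<^sup>L \<nu> g = integral\<^sup>L N (\<lambda>x. g (c x))"
      unfolding \<nu>_def using c_meas C01_measurable[OF g] by (rule integral_distr)
    ultimately show ?thesis by simp
  qed
  ultimately show ?thesis using r that by blast
qed

lemma wdist_sums:
  assumes "range \<Psi> \<subseteq> C01" "\<mu> \<in> prob01" "\<nu> \<in> prob01"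
  shows "(\<lambda>i. (1 / 2) ^ Suc i * \<bar>integral\<^sup>L \<mu> (\<Psi> i) - integral\<^sup>L \<nu> (\<Psi> i)\<bar>) sums wdist \<Psi> \<mu> \<nu>"
  unfolding wdist_def using wdist_summable[OF assms] by (intro has_sum_imp_sums has_sum_infsum)

text \<open>The first \<open>N\<close> terms contribute at most \<open>e\<close> and the remaining ones at most the tail of the geometric
series, since integrals of functions with values in \<open>[0,1]\<close> differ by at most \<open>1\<close>.\<close>

lemma wdist_le:
  assumes "range \<Psi> \<subseteq> C01" "\<mu> \<in> prob01" "\<nu> \<in> prob01"
    and "\<And>i. i < N \<Longrightarrow> \<bar>integral\<^sup>L \<mu> (\<Psi> i) - integral\<^sup>L \<nu> (\<Psi> i)\<bar> \<le> e" "0 \<le> e"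
  shows "wdist \<Psi> \<mu> \<nu> \<le> e + (1 / 2) ^ N"
proof -
  have tail: "(\<lambda>i. if i < N then 0 else (1 / 2) ^ Suc i :: real) sums ((1 / 2) ^ N)"
  proof -
    have "(\<lambda>i. (1 / 2) ^ N * (1 / 2) ^ Suc i :: real) sums ((1 / 2) ^ N * 1)"
      by (intro sums_mult power_half_series)
    then have "(\<lambda>i. if i + N < N then 0 else (1 / 2) ^ Suc (i + N) :: real) sums ((1 / 2) ^ N)"
      by (simp add: power_add mult_ac)
    then show ?thesis
      using sums_iff_shift[of "\<lambda>i. if i < N then 0 else (1 / 2) ^ Suc i :: real" N] by simp
  qed
  have "(\<lambda>i. e * (1 / 2) ^ Suc i + (if i < N then 0 else (1 / 2) ^ Suc i)) sums (e * 1 + (1 / 2) ^ N)"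
    by (intro sums_add sums_mult power_half_series tail)
  moreover have "(1 / 2) ^ Suc i * \<bar>integral\<^sup>L \<mu> (\<Psi> i) - integral\<^sup>L \<nu> (\<Psi> i)\<bar>
      \<le> e * (1 / 2) ^ Suc i + (if i < N then 0 else (1 / 2) ^ Suc i)" for i
  proof (cases "i < N")
    case True
    then show ?thesis using assms(4)[of i] by (simp add: mult_ac)
  next
    case False
    have "\<bar>integral\<^sup>L \<mu> (\<Psi> i) - integral\<^sup>L \<nu> (\<Psi> i)\<bar> \<le> 1"
      using C01_integral_bounds[of \<mu> "\<Psi> i"] C01_integral_bounds[of \<nu> "\<Psi> i"] assms(1-3)
      by (auto simp: abs_le_iff image_subset_iff)
    then have "(1 / 2) ^ Suc i * \<bar>integral\<^sup>L \<mu> (\<Psi> i) - integral\<^sup>L \<nu> (\<Psi> i)\<bar> \<le> (1 / 2) ^ Suc i"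
      by (intro mult_left_le) auto
    moreover have "0 \<le> e * (1 / 2) ^ Suc i" using assms(5) by simp
    ultimately show ?thesis using False by (simp only: if_False)
  qed
  ultimately have "wdist \<Psi> \<mu> \<nu> \<le> e * 1 + (1 / 2) ^ N"
    using wdist_sums[OF assms(1-3)] by (rule sums_le[rotated 2])
  then show ?thesis by simp
qed

lemma wdist_tendsto_0:
  assumes "range \<Psi> \<subseteq> C01" "\<And>n. \<nu> n \<in> prob01" "\<mu> \<in> prob01"
    and "\<And>g. g \<in> C01 \<Longrightarrow> (\<lambda>n. integral\<^sup>L (\<nu> n) g) \<longlonglongrightarrow> integral\<^sup>L \<mu> g"
  shows "(\<lambda>n. wdist \<Psi> (\<nu> n) \<mu>) \<longlonglongrightarrow> 0"
proof (rule LIMSEQ_I)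
  fix e :: real assume e: "e > 0"
  obtain N where N: "(1 / 2 :: real) ^ N < e / 2"
    using real_arch_pow_inv[of "e / 2" "1 / 2"] e by auto
  have "eventually (\<lambda>n. \<forall>i\<in>{..<N}. \<bar>integral\<^sup>L (\<nu> n) (\<Psi> i) - integral\<^sup>L \<mu> (\<Psi> i)\<bar> < e / 2) sequentially"
  proof (intro eventually_ball_finite ballI)
    fix i
    have "\<Psi> i \<in> C01" using assms(1) by auto
    from tendstoD[OF assms(4)[OF this] half_gt_zero[OF e]]
    show "eventually (\<lambda>n. \<bar>integral\<^sup>L (\<nu> n) (\<Psi> i) - integral\<^sup>L \<mu> (\<Psi> i)\<bar> < e / 2) sequentially"
      by (simp add: dist_real_def)
  qed simp
  then obtain n0 where n0: "\<And>n i. n \<ge> n0 \<Longrightarrow> i < N \<Longrightarrow> \<bar>integral\<^sup>L (\<nu> n) (\<Psi> i) - integral\<^sup>L \<mu> (\<Psi> i)\<bar> < e / 2"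
    by (auto simp: eventually_sequentially)
  have "norm (wdist \<Psi> (\<nu> n) \<mu> - 0) < e" if "n \<ge> n0" for n
  proof -
    have "wdist \<Psi> (\<nu> n) \<mu> \<le> e / 2 + (1 / 2) ^ N"
      using n0[OF that] e by (intro wdist_le assms(1-3) less_imp_le) auto
    moreover have "0 \<le> wdist \<Psi> (\<nu> n) \<mu>" by (auto simp: wdist_def intro!: infsum_nonneg)
    ultimately show ?thesis using N by simp
  qed
  then show "\<exists>n0. \<forall>n\<ge>n0. norm (wdist \<Psi> (\<nu> n) \<mu> - 0) < e" by blast
qed

lemma limitin_weak_star_iff:
  assumes "dense_sequence \<Psi>"
  shows "limitin (weak_star \<Psi>) \<nu> \<mu> F \<longleftrightarrow>
    \<mu> \<in> prob01 \<and> eventually (\<lambda>n. \<nu> n \<in> prob01) F \<and> ((\<lambda>n. wdist \<Psi> (\<nu> n) \<mu>) \<longlongrightarrow> 0) F"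
  unfolding weak_star_def by (rule Metric_space.limitin_metric_dist_null[OF Metric_space_wdist[OF assms]])

text \<open>Only finitely many of the functions \<open>\<Psi> i\<close> matter up to \<open>e / 2\<close>, and these are uniformly continuous.
The bound on the distance of the orbits depends neither on the map nor on the length of the
orbits.\<close>

lemma wdist_empirical_close:
  assumes "range \<Psi> \<subseteq> C01" "e > 0"
  obtains \<eta> where "\<eta> > 0"
    "\<And>f x y n. f \<in> C01 \<Longrightarrow> x \<in> {0..1} \<Longrightarrow> y \<in> {0..1} \<Longrightarrow> n > 0 \<Longrightarrow>
       (\<And>j. j < n \<Longrightarrow> \<bar>(f ^^ j) x - (f ^^ j) y\<bar> < \<eta>) \<Longrightarrow>
       wdist \<Psi> (empirical f x n) (empirical f y n) < e"
proof -
  obtain N where N: "(1 / 2 :: real) ^ N < e / 2"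
    using real_arch_pow_inv[of "e / 2" "1 / 2"] assms(2) by auto
  have "\<exists>d>0. \<forall>x\<in>{0..1}. \<forall>y\<in>{0..1}. \<bar>x - y\<bar> < d \<longrightarrow> \<bar>\<Psi> i x - \<Psi> i y\<bar> < e / 2" for i
  proof -
    have "\<Psi> i \<in> C01" using assms(1) by auto
    from C01_uniformly_continuous[OF this half_gt_zero[OF assms(2)]] show ?thesis by metis
  qed
  then obtain d where d: "\<And>i. d i > 0"
    "\<And>i x y. x \<in> {0..1} \<Longrightarrow> y \<in> {0..1} \<Longrightarrow> \<bar>x - y\<bar> < d i \<Longrightarrow> \<bar>\<Psi> i x - \<Psi> i y\<bar> < e / 2"
    by metis
  define \<eta> where "\<eta> = Min (insert 1 (d ` {..<N}))"
  have \<eta>: "\<eta> > 0" "\<And>i. i < N \<Longrightarrow> \<eta> \<le> d i" using d(1) by (auto simp: \<eta>_def)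
  have "wdist \<Psi> (empirical f x n) (empirical f y n) < e"
    if f: "f \<in> C01" and xy: "x \<in> {0..1}" "y \<in> {0..1}" and n: "n > 0"
      and close: "\<And>j. j < n \<Longrightarrow> \<bar>(f ^^ j) x - (f ^^ j) y\<bar> < \<eta>" for f x y n
  proof -
    have "\<bar>integral\<^sup>L (empirical f x n) (\<Psi> i) - integral\<^sup>L (empirical f y n) (\<Psi> i)\<bar> \<le> e / 2"
      if i: "i < N" for i
    proof -
      have \<Psi>: "\<Psi> i \<in> C01" using assms(1) by auto
      have "\<bar>(\<Sum>j<n. \<Psi> i ((f ^^ j) x)) - (\<Sum>j<n. \<Psi> i ((f ^^ j) y))\<bar>
          \<le> (\<Sum>j<n. \<bar>\<Psi> i ((f ^^ j) x) - \<Psi> i ((f ^^ j) y)\<bar>)"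
        unfolding sum_subtractf[symmetric] by (rule sum_abs)
      also have "\<dots> \<le> (\<Sum>j<n. e / 2)"
        using close \<eta>(2)[OF i] C01_funpow[OF f] xy
        by (intro sum_mono less_imp_le[OF d(2)]) (auto intro: less_le_trans)
      also have "\<dots> = real n * (e / 2)" by simp
      finally show ?thesis
        using n unfolding integral_empirical[OF f xy(1) \<Psi>] integral_empirical[OF f xy(2) \<Psi>]
          diff_divide_distrib[symmetric] by (simp add: divide_le_eq mult_ac)
    qed
    then have "wdist \<Psi> (empirical f x n) (empirical f y n) \<le> e / 2 + (1 / 2) ^ N"
      using assms(2) f xy n by (intro wdist_le assms(1) empirical_in_prob01) auto
    then show ?thesis using N by simp
  qed
  with \<eta>(1) show ?thesis by (rule that)
qed

lemma empirical_multiple_period: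
  assumes f: "f \<in> C01" and z: "z \<in> {0..1}" "(f ^^ p) z = z" and "p > 0" "m > 0"
  shows "empirical f z (p * m) = empirical f z p"
proof (rule prob01_eqI)
  fix g assume g: "g \<in> C01"
  have shift: "(f ^^ (p * k + j)) z = (f ^^ j) z" for k j
    using funpow_mod_eq[OF z(2), of "p * k + j"] funpow_mod_eq[OF z(2), of j] by simp
  have "(\<Sum>j<p * m. g ((f ^^ j) z)) = real m * (\<Sum>j<p. g ((f ^^ j) z))" for m
  proof (induction m)
    case (Suc m)
    have "(\<Sum>j<p * m + p. g ((f ^^ j) z)) = (\<Sum>j<p * m. g ((f ^^ j) z)) + (\<Sum>j\<in>{p * m..<p * m + p}. g ((f ^^ j) z))"
      using sum.atLeastLessThan_concat[of 0 "p * m" "p * m + p" "\<lambda>j. g ((f ^^ j) z)"]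
      by (simp add: atLeast0LessThan)
    also have "(\<Sum>j\<in>{p * m..<p * m + p}. g ((f ^^ j) z)) = (\<Sum>j<p. g ((f ^^ (p * m + j)) z))"
      using sum.shift_bounds_nat_ivl[of "\<lambda>j. g ((f ^^ j) z)" 0 "p * m" p]
      by (simp add: atLeast0LessThan add.commute)
    finally show ?case using Suc by (simp only: shift) (simp add: algebra_simps)
  qed simp
  then show "integral\<^sup>L (empirical f z (p * m)) g = integral\<^sup>L (empirical f z p) g"
    using assms(4,5) by (simp add: integral_empirical[OF f z(1) g])
qed (use assms in \<open>auto intro: empirical_in_prob01\<close>)

lemma empirical_periodic_invariant:
  assumes f: "f \<in> C01" and z: "z \<in> {0..1}" "(f ^^ p) z = z" and "p > 0"
  shows "empirical f z p \<in> invariant_measures f"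
proof (rule invariant_measuresI[OF empirical_in_prob01[OF f z(1) assms(4)] f])
  fix g assume g: "g \<in> C01"
  have "(\<Sum>j<p. g ((f ^^ Suc j) z)) = (\<Sum>j<p. g ((f ^^ j) z))"
    using sum.lessThan_Suc_shift[of "\<lambda>j. g ((f ^^ j) z)" p] z(2) by simp
  moreover have "(\<Sum>j<p. restrict (g \<circ> f) {0..1} ((f ^^ j) z)) = (\<Sum>j<p. g ((f ^^ Suc j) z))"
    using C01_funpow[OF f z(1)] by (intro sum.cong) auto
  ultimately show "integral\<^sup>L (empirical f z p) (restrict (g \<circ> f) {0..1}) = integral\<^sup>L (empirical f z p) g"
    by (simp add: integral_empirical[OF f z(1)] C01_compose[OF f g] g)
qed

section \<open>Pseudo-physical measures near periodic orbits\<close>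

lemma p_omega_subset_prob01: "dense_sequence \<Psi> \<Longrightarrow> p_omega \<Psi> f x \<subseteq> prob01"
  by (auto simp: p_omega_def limitin_weak_star_iff)

text \<open>Sequential compactness provides a limit along a subsequence of the given times, and the distance to
\<open>\<mu>\<close> is continuous.\<close>

lemma wdist_p_omega_limit_point:
  assumes \<Psi>: "dense_sequence \<Psi>" and f: "f \<in> C01" "x \<in> {0..1}" and \<mu>: "\<mu> \<in> prob01"
    and "infinite {n. wdist \<Psi> (empirical f x n) \<mu> \<le> c}"
  shows "\<exists>\<nu>\<in>p_omega \<Psi> f x. wdist \<Psi> \<nu> \<mu> \<le> c"
proof -
  interpret Metric_space prob01 "wdist \<Psi>" by (rule Metric_space_wdist[OF \<Psi>])
  \<comment> \<open>at \<open>n = 0\<close> the empirical measure is not a probability measure\<close>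
  have "infinite ({n. wdist \<Psi> (empirical f x n) \<mu> \<le> c} - {0})" using assms(5) by simp
  then obtain r :: "nat \<Rightarrow> nat" where r: "strict_mono r"
    "\<And>n. r n \<in> {n. wdist \<Psi> (empirical f x n) \<mu> \<le> c} - {0}"
    using infinite_enumerate by meson
  have E: "empirical f x (r n) \<in> prob01" for n
    using r(2)[of n] f by (auto intro: empirical_in_prob01)
  obtain s \<nu> where s: "strict_mono (s :: nat \<Rightarrow> nat)" and \<nu>: "\<nu> \<in> prob01"
    and conv: "\<And>g. g \<in> C01 \<Longrightarrow> (\<lambda>k. integral\<^sup>L (empirical f x (r (s k))) g) \<longlonglongrightarrow> integral\<^sup>L \<nu> g"
    using prob01_sequentially_compact[of "\<lambda>n. empirical f x (r n)"] E by blast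
  have lim: "(\<lambda>k. wdist \<Psi> (empirical f x (r (s k))) \<nu>) \<longlonglongrightarrow> 0"
    using \<Psi> E \<nu> conv by (intro wdist_tendsto_0) (auto simp: dense_sequence_def)
  then have "\<nu> \<in> p_omega \<Psi> f x"
    unfolding p_omega_def using strict_mono_o[OF r(1) s] \<nu> E
    by (intro CollectI exI[of _ "r \<circ> s"]) (simp add: limitin_weak_star_iff[OF \<Psi>] o_def)
  moreover have "wdist \<Psi> \<nu> \<mu> \<le> c"
  proof (rule LIMSEQ_le_const)
    show "(\<lambda>k. wdist \<Psi> (empirical f x (r (s k))) \<nu> + c) \<longlonglongrightarrow> c"
      using tendsto_add[OF lim tendsto_const[of c]] by simp
    have "wdist \<Psi> \<nu> \<mu> \<le> wdist \<Psi> (empirical f x (r (s k))) \<nu> + c" for k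
      using triangle[OF \<nu> E[of "s k"] \<mu>] r(2)[of "s k"] commute[of \<nu>] by simp
    then show "\<exists>N. \<forall>n\<ge>N. wdist \<Psi> \<nu> \<mu> \<le> wdist \<Psi> (empirical f x (r (s n))) \<nu> + c" by blast
  qed
  ultimately show ?thesis by blast
qed

lemma p_omega_nonempty:
  assumes \<Psi>: "dense_sequence \<Psi>" and f: "f \<in> C01" "x \<in> {0..1}"
  shows "p_omega \<Psi> f x \<noteq> {}"
proof -
  obtain \<mu> where \<mu>: "\<mu> \<in> prob01" using empirical_in_prob01[OF f, of 1] by auto
  have "wdist \<Psi> (empirical f x (Suc n)) \<mu> \<le> 1" for n
    using wdist_le[OF _ empirical_in_prob01[OF f] \<mu>, of \<Psi> "Suc n" 0 0] \<Psi>
    by (simp add: dense_sequence_def)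
  then have "range Suc \<subseteq> {n. wdist \<Psi> (empirical f x n) \<mu> \<le> 1}" by blast
  moreover have "infinite (range Suc)" by (rule range_inj_infinite) simp
  ultimately have "infinite {n. wdist \<Psi> (empirical f x n) \<mu> \<le> 1}" by (rule infinite_super)
  with wdist_p_omega_limit_point[OF \<Psi> f \<mu>] show ?thesis by blast
qed

lemma wdist_set_p_omega_less_iff:
  assumes \<Psi>: "dense_sequence \<Psi>" and f: "f \<in> C01" "x \<in> {0..1}"
  shows "wdist_set \<Psi> (p_omega \<Psi> f x) \<mu> < e \<longleftrightarrow> (\<exists>\<nu>\<in>p_omega \<Psi> f x. wdist \<Psi> \<nu> \<mu> < e)"
  unfolding wdist_set_def
proof (rule cINF_less_iff[OF p_omega_nonempty[OF assms]])
  show "bdd_below ((\<lambda>\<nu>. wdist \<Psi> \<nu> \<mu>) ` p_omega \<Psi> f x)"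
    by (rule bdd_belowI2[of _ 0]) (auto simp: wdist_def intro!: infsum_nonneg)
qed

text \<open>The distance from the limit set is the lower limit of the distances of the empirical measures. This
form refers to countably many functions of \<open>x\<close> only, each of which is measurable.\<close>

lemma wdist_set_p_omega_less_iff_infinite:
  assumes \<Psi>: "dense_sequence \<Psi>" and f: "f \<in> C01" "x \<in> {0..1}" and \<mu>: "\<mu> \<in> prob01"
  shows "wdist_set \<Psi> (p_omega \<Psi> f x) \<mu> < e \<longleftrightarrow>
    (\<exists>k. infinite {n. wdist \<Psi> (empirical f x n) \<mu> \<le> e - 1 / real (Suc k)})"
proof
  interpret Metric_space prob01 "wdist \<Psi>" by (rule Metric_space_wdist[OF \<Psi>])
  assume "wdist_set \<Psi> (p_omega \<Psi> f x) \<mu> < e"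
  then obtain \<nu> r where \<nu>: "wdist \<Psi> \<nu> \<mu> < e" "\<nu> \<in> prob01" and r: "strict_mono (r :: nat \<Rightarrow> nat)"
    and conv: "eventually (\<lambda>k. empirical f x (r k) \<in> prob01) sequentially"
      "(\<lambda>k. wdist \<Psi> (empirical f x (r k)) \<nu>) \<longlonglongrightarrow> 0"
    unfolding wdist_set_p_omega_less_iff[OF assms(1-3)]
    by (auto simp: p_omega_def limitin_weak_star_iff[OF \<Psi>])
  define d where "d = (e - wdist \<Psi> \<nu> \<mu>) / 2"
  have d: "d > 0" "e - d = wdist \<Psi> \<nu> \<mu> + d" using \<nu>(1) by (simp_all add: d_def field_simps)
  obtain k where k: "1 / real (Suc k) < d"
    using reals_Archimedean[OF d(1)] by (auto simp: inverse_eq_divide)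
  have "eventually (\<lambda>k. wdist \<Psi> (empirical f x (r k)) \<nu> < d) sequentially"
    using order_tendstoD(2)[OF conv(2) d(1)] .
  with conv(1) have "eventually (\<lambda>j. wdist \<Psi> (empirical f x (r j)) \<mu> \<le> e - 1 / real (Suc k)) sequentially"
  proof eventually_elim
    case (elim j)
    then show ?case using triangle[OF elim(1) \<nu>(2) \<mu>] d(2) k by linarith
  qed
  then obtain J where "\<And>j. j \<ge> J \<Longrightarrow> wdist \<Psi> (empirical f x (r j)) \<mu> \<le> e - 1 / real (Suc k)"
    by (auto simp: eventually_sequentially)
  then have "r ` {J..} \<subseteq> {n. wdist \<Psi> (empirical f x n) \<mu> \<le> e - 1 / real (Suc k)}" by auto
  moreover have "infinite (r ` {J..})"
    using strict_mono_imp_inj_on[OF r] by (simp add: finite_image_iff inj_on_subset infinite_Ici)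
  ultimately show "\<exists>k. infinite {n. wdist \<Psi> (empirical f x n) \<mu> \<le> e - 1 / real (Suc k)}"
    using infinite_super by blast
next
  assume "\<exists>k. infinite {n. wdist \<Psi> (empirical f x n) \<mu> \<le> e - 1 / real (Suc k)}"
  then obtain k where "infinite {n. wdist \<Psi> (empirical f x n) \<mu> \<le> e - 1 / real (Suc k)}" ..
  from wdist_p_omega_limit_point[OF assms this]
  show "wdist_set \<Psi> (p_omega \<Psi> f x) \<mu> < e"
    unfolding wdist_set_p_omega_less_iff[OF assms(1-3)]
    by (smt (verit) divide_pos_pos of_nat_0_less_iff zero_less_Suc)
qed

lemma measurable_funpow_C01: "f \<in> C01 \<Longrightarrow> f ^^ j \<in> borel01 \<rightarrow>\<^sub>M borel01"
  by (induction j) (auto intro: measurable_comp[OF _ measurable_C01_borel01] simp: id_def)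

text \<open>The Lebesgue measure of these sets can only be bounded from below by monotonicity once they are
known to be measurable.\<close>

lemma sets_wdist_set_p_omega:
  assumes \<Psi>: "dense_sequence \<Psi>" and f: "f \<in> C01" and \<mu>: "\<mu> \<in> prob01"
  shows "{x \<in> {0..1}. wdist_set \<Psi> (p_omega \<Psi> f x) \<mu> < e} \<in> sets lebesgue"
proof -
  have sub: "range \<Psi> \<subseteq> C01" using \<Psi> by (simp add: dense_sequence_def)
  have meas: "{x \<in> space borel01. wdist \<Psi> (empirical f x n) \<mu> \<le> c} \<in> sets borel01" if n: "n > 0" for n c
  proof -
    have "\<Psi> i \<in> C01" for i using sub by auto
    then have "(\<lambda>x. \<Psi> i ((f ^^ j) x)) \<in> borel_measurable borel01" for i j
      by (intro measurable_compose[OF measurable_funpow_C01[OF f] C01_measurable])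
    then have "(\<lambda>x. \<Sum>i. (1 / 2) ^ Suc i * \<bar>(\<Sum>j<n. \<Psi> i ((f ^^ j) x)) / real n - integral\<^sup>L \<mu> (\<Psi> i)\<bar>)
        \<in> borel_measurable borel01"
      by measurable
    moreover have "(\<Sum>i. (1 / 2) ^ Suc i * \<bar>(\<Sum>j<n. \<Psi> i ((f ^^ j) x)) / real n - integral\<^sup>L \<mu> (\<Psi> i)\<bar>)
        = wdist \<Psi> (empirical f x n) \<mu>" if "x \<in> space borel01" for x
    proof -
      have x: "x \<in> {0..1}" using that by simp
      have "\<Psi> i \<in> C01" for i using sub by auto
      then show ?thesis
        using sums_unique[OF wdist_sums[OF sub empirical_in_prob01[OF f x n] \<mu>]]
        by (simp add: integral_empirical[OF f x])
    qed
    ultimately have "(\<lambda>x. wdist \<Psi> (empirical f x n) \<mu>) \<in> borel_measurable borel01"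
      by (rule iffD1[OF measurable_cong, rotated])
    then show ?thesis by measurable
  qed
  have inf: "infinite N \<longleftrightarrow> (\<forall>m. \<exists>n. m + Suc n \<in> N)" for N :: "nat set"
    unfolding infinite_nat_iff_unbounded by (metis less_iff_Suc_add add_Suc_right)
  have "{x \<in> {0..1}. wdist_set \<Psi> (p_omega \<Psi> f x) \<mu> < e} =
    {x \<in> space borel01. \<exists>k. \<forall>m. \<exists>n. wdist \<Psi> (empirical f x (m + Suc n)) \<mu> \<le> e - 1 / real (Suc k)}"
    unfolding space_borel01
  proof (rule Collect_cong, rule conj_cong[OF refl])
    fix x :: real assume "x \<in> {0..1}"
    from wdist_set_p_omega_less_iff_infinite[OF \<Psi> f this \<mu>]
    show "wdist_set \<Psi> (p_omega \<Psi> f x) \<mu> < e \<longleftrightarrow>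
        (\<exists>k. \<forall>m. \<exists>n. wdist \<Psi> (empirical f x (m + Suc n)) \<mu> \<le> e - 1 / real (Suc k))"
      unfolding inf mem_Collect_eq .
  qed
  also have "\<dots> \<in> sets borel01"
    by (intro sets.sets_Collect_countable_Ex sets.sets_Collect_countable_All meas) simp
  finally have "{x \<in> {0..1}. wdist_set \<Psi> (p_omega \<Psi> f x) \<mu> < e} \<in> sets borel"
    by (auto simp: borel01_def sets_restrict_space)
  then show ?thesis by simp
qed

text \<open>The points of a shadowing interval have empirical measures close to that of the periodic orbit, at
least at multiples of the period, where the latter is exact.\<close>

lemma pseudo_physical_periodic:
  assumes \<Psi>: "dense_sequence \<Psi>" and f: "f \<in> C01" and z: "z \<in> {0..1}" "(f ^^ p) z = z" and p: "p > 0"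
    and sh: "shadowed f z"
  shows "empirical f z p \<in> pseudo_physical_measures \<Psi> f"
proof -
  define \<mu> where "\<mu> = empirical f z p"
  have \<mu>: "\<mu> \<in> prob01" using empirical_in_prob01[OF f z(1) p] by (simp add: \<mu>_def)
  have "0 < emeasure lebesgue {x \<in> {0..1}. wdist_set \<Psi> (p_omega \<Psi> f x) \<mu> < e}" if e: "e > 0" for e
  proof -
    have "range \<Psi> \<subseteq> C01" using \<Psi> by (simp add: dense_sequence_def)
    then obtain \<eta> where \<eta>: "\<eta> > 0"
      "\<And>f x y n. f \<in> C01 \<Longrightarrow> x \<in> {0..1} \<Longrightarrow> y \<in> {0..1} \<Longrightarrow> n > 0 \<Longrightarrow>
       (\<And>j. j < n \<Longrightarrow> \<bar>(f ^^ j) x - (f ^^ j) y\<bar> < \<eta>) \<Longrightarrow>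
       wdist \<Psi> (empirical f x n) (empirical f y n) < e / 2"
      using wdist_empirical_close[OF _ half_gt_zero[OF e]] by metis
    obtain a b where ab: "0 \<le> a" "a < b" "b \<le> 1"
      "\<And>y j. y \<in> {a..b} \<Longrightarrow> \<bar>(f ^^ j) y - (f ^^ j) z\<bar> < \<eta>"
      using sh \<eta>(1) unfolding shadowed_def by metis
    have "wdist_set \<Psi> (p_omega \<Psi> f y) \<mu> < e" if y: "y \<in> {a..b}" for y
    proof -
      have y01: "y \<in> {0..1}" using y ab by auto
      have "wdist \<Psi> (empirical f y (p * Suc m)) \<mu> \<le> e / 2" for m
        using \<eta>(2)[OF f y01 z(1), of "p * Suc m"] ab(4)[OF y] p
          empirical_multiple_period[OF f z p, of "Suc m"] by (simp add: \<mu>_def)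
      then have "range (\<lambda>m. p * Suc m) \<subseteq> {n. wdist \<Psi> (empirical f y n) \<mu> \<le> e / 2}" by blast
      moreover have "infinite (range (\<lambda>m. p * Suc m))"
        using p by (intro range_inj_infinite injI) simp
      ultimately have "infinite {n. wdist \<Psi> (empirical f y n) \<mu> \<le> e / 2}"
        using infinite_super by blast
      from wdist_p_omega_limit_point[OF \<Psi> f y01 \<mu> this]
      show ?thesis
        unfolding wdist_set_p_omega_less_iff[OF \<Psi> f y01] using e by (metis field_less_half_sum half_gt_zero_iff le_less_trans add_0 field_sum_of_halves less_add_same_cancel1)
    qed
    then have "{a..b} \<subseteq> {x \<in> {0..1}. wdist_set \<Psi> (p_omega \<Psi> f x) \<mu> < e}"
      using ab by auto
    then have "emeasure lebesgue {a..b} \<le> emeasure lebesgue {x \<in> {0..1}. wdist_set \<Psi> (p_omega \<Psi> f x) \<mu> < e}"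
      using sets_wdist_set_p_omega[OF \<Psi> f \<mu>] by (rule emeasure_mono)
    moreover have "0 < emeasure lebesgue {a..b}" using ab(2) by simp
    ultimately show ?thesis by (rule less_le_trans[rotated])
  qed
  then show ?thesis using \<mu> by (simp add: pseudo_physical_measures_def pseudo_physical_def \<mu>_def)
qed

lemma pseudo_physical_limit:
  assumes \<Psi>: "dense_sequence \<Psi>" and f: "f \<in> C01" and \<nu>: "\<And>n. \<nu> n \<in> pseudo_physical_measures \<Psi> f"
    and \<mu>: "\<mu> \<in> prob01" and lim: "(\<lambda>n. wdist \<Psi> (\<nu> n) \<mu>) \<longlonglongrightarrow> 0"
  shows "\<mu> \<in> pseudo_physical_measures \<Psi> f"
proof -
  interpret Metric_space prob01 "wdist \<Psi>" by (rule Metric_space_wdist[OF \<Psi>])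
  have "0 < emeasure lebesgue {x \<in> {0..1}. wdist_set \<Psi> (p_omega \<Psi> f x) \<mu> < e}" if e: "e > 0" for e
  proof -
    obtain n where n: "wdist \<Psi> (\<nu> n) \<mu> < e / 2"
      using order_tendstoD(2)[OF lim half_gt_zero[OF e]] by (auto simp: eventually_sequentially)
    have \<nu>n: "\<nu> n \<in> prob01" "0 < emeasure lebesgue {x \<in> {0..1}. wdist_set \<Psi> (p_omega \<Psi> f x) (\<nu> n) < e / 2}"
      using \<nu>[of n] half_gt_zero[OF e]
      unfolding pseudo_physical_measures_def pseudo_physical_def mem_Collect_eq by fast+
    have "wdist_set \<Psi> (p_omega \<Psi> f x) \<mu> < e"
      if x: "x \<in> {0..1}" "wdist_set \<Psi> (p_omega \<Psi> f x) (\<nu> n) < e / 2" for x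
    proof -
      obtain \<rho> where \<rho>: "\<rho> \<in> p_omega \<Psi> f x" "wdist \<Psi> \<rho> (\<nu> n) < e / 2"
        using x(2) unfolding wdist_set_p_omega_less_iff[OF \<Psi> f x(1)] by blast
      moreover have "wdist \<Psi> \<rho> \<mu> \<le> wdist \<Psi> \<rho> (\<nu> n) + wdist \<Psi> (\<nu> n) \<mu>"
        using \<rho>(1) p_omega_subset_prob01[OF \<Psi>] by (intro triangle \<nu>n(1) \<mu>) auto
      ultimately show ?thesis
        unfolding wdist_set_p_omega_less_iff[OF \<Psi> f x(1)] using n by (intro bexI[of _ \<rho>]) auto
    qed
    then have "emeasure lebesgue {x \<in> {0..1}. wdist_set \<Psi> (p_omega \<Psi> f x) (\<nu> n) < e / 2}
        \<le> emeasure lebesgue {x \<in> {0..1}. wdist_set \<Psi> (p_omega \<Psi> f x) \<mu> < e}"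
      by (intro emeasure_mono sets_wdist_set_p_omega[OF \<Psi> f \<mu>]) auto
    with \<nu>n(2) show ?thesis by (rule less_le_trans)
  qed
  then show ?thesis using \<mu> by (simp add: pseudo_physical_measures_def pseudo_physical_def)
qed

section \<open>Entropy of periodic orbit measures\<close>

lemma measure_empirical:
  assumes "f \<in> C01" "x \<in> {0..1}" "A \<in> sets borel01"
  shows "measure (empirical f x n) A = card {j. j < n \<and> (f ^^ j) x \<in> A} / n"
proof -
  have "(\<lambda>j. (f ^^ j) x) \<in> uniform_count_measure {..<n} \<rightarrow>\<^sub>M borel01"
    using C01_funpow[OF assms(1,2)] by (simp add: measurable_def space_uniform_count_measure
        sets_uniform_count_measure)
  then have "measure (empirical f x n) A
      = measure (uniform_count_measure {..<n}) ((\<lambda>j. (f ^^ j) x) -` A \<inter> {..<n})"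
    using assms(3) by (simp add: empirical_def measure_distr space_uniform_count_measure)
  also have "\<dots> = card ((\<lambda>j. (f ^^ j) x) -` A \<inter> {..<n}) / card {..<n}"
    by (rule measure_uniform_count_measure) auto
  also have "(\<lambda>j. (f ^^ j) x) -` A \<inter> {..<n} = {j. j < n \<and> (f ^^ j) x \<in> A}" by auto
  finally show ?thesis by simp
qed

lemma cell_in_sets:
  assumes "f \<in> C01" "\<And>i. i < n \<Longrightarrow> c i \<in> sets borel01"
  shows "{x \<in> {0..1}. \<forall>i<n. (f ^^ i) x \<in> c i} \<in> sets borel01"
proof -
  have "{x \<in> space borel01. (f ^^ i) x \<in> c i} \<in> sets borel01" if "i \<in> {..<n}" for i
    using measurable_sets[OF measurable_funpow_C01[OF assms(1)] assms(2), of i i] that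
    by (simp add: vimage_def Int_def conj_commute)
  then have "{x \<in> space borel01. \<forall>i\<in>{..<n}. (f ^^ i) x \<in> c i} \<in> sets borel01"
    by (intro sets.sets_Collect_finite_All) auto
  then show ?thesis by (simp add: Ball_def)
qed

text \<open>A point determines the cells of \<open>P\<close> that it visits.\<close>

lemma disjoint_iterated_join:
  assumes "partition_on (space \<mu>) P"
  shows "disjoint (iterated_join \<mu> f P n)"
proof (rule disjointI)
  fix A B assume AB: "A \<in> iterated_join \<mu> f P n" "B \<in> iterated_join \<mu> f P n" "A \<noteq> B"
  then obtain c c' where c: "c \<in> {..<n} \<rightarrow>\<^sub>E P" "A = {x \<in> space \<mu>. \<forall>i<n. (f ^^ i) x \<in> c i}"
    and c': "c' \<in> {..<n} \<rightarrow>\<^sub>E P" "B = {x \<in> space \<mu>. \<forall>i<n. (f ^^ i) x \<in> c' i}"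
    by (auto simp: iterated_join_def)
  show "A \<inter> B = {}"
  proof (rule ccontr)
    assume "A \<inter> B \<noteq> {}"
    then obtain x where x: "x \<in> A" "x \<in> B" by blast
    have eq: "c i = c' i" if "i < n" for i
    proof (rule ccontr)
      assume "c i \<noteq> c' i"
      moreover have "c i \<in> P" "c' i \<in> P" using c(1) c'(1) that by (auto simp: PiE_iff)
      ultimately have "c i \<inter> c' i = {}" using partition_onD2[OF assms] by (auto dest: disjointD)
      moreover have "(f ^^ i) x \<in> c i \<inter> c' i" using x c(2) c'(2) that by auto
      ultimately show False by blast
    qed
    have "A = B" unfolding c(2) c'(2) using eq by (intro Collect_cong) simp
    with AB(3) show False by simp
  qed
qed

text \<open>If no cell has positive measure below \<open>1 / p\<close>, then \<open>- ln\<close> of the measure of every relevant cell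
lies between \<open>0\<close> and \<open>ln p\<close>, and the entropy is a combination of such numbers with weights of sum at most \<open>1\<close>.\<close>

lemma partition_entropy_bounds:
  assumes "prob_space M" "finite J" "J \<subseteq> sets M" "disjoint J" "p > 0"
    and atom: "\<And>A. A \<in> J \<Longrightarrow> measure M A = 0 \<or> 1 / real p \<le> measure M A"
  shows "0 \<le> partition_entropy M J" "partition_entropy M J \<le> ln p"
proof -
  interpret prob_space M by fact
  have "- (prob A * ln (prob A)) \<in> {0..prob A * ln p}" if "A \<in> J" for A
  proof (cases "prob A = 0")
    case False
    then have 1: "1 / real p \<le> prob A" using atom[OF that] by simp
    have pos: "0 < prob A" using False by (simp add: zero_less_measure_iff)
    have "- ln (prob A) \<le> ln p"
      using ln_mono[OF 1] pos assms(5) by (simp add: ln_div)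
    moreover have "0 \<le> - ln (prob A)" using pos by simp
    ultimately show ?thesis
      using pos mult_left_mono[of 0 "- ln (prob A)" "prob A"]
        mult_left_mono[of "- ln (prob A)" "ln p" "prob A"] by simp
  qed simp
  note * = this
  show "0 \<le> partition_entropy M J"
    unfolding partition_entropy_def sum_negf[symmetric] using * by (intro sum_nonneg) simp
  have "(\<Sum>A\<in>J. prob A) = prob (\<Union>A\<in>J. A)"
    using assms(2-4) by (intro finite_measure_finite_Union[symmetric])
      (auto simp: disjoint_family_on_def disjoint_def)
  then have le1: "(\<Sum>A\<in>J. prob A) \<le> 1" by simp
  have "partition_entropy M J \<le> (\<Sum>A\<in>J. prob A * ln p)"
    unfolding partition_entropy_def sum_negf[symmetric] using * by (intro sum_mono) simp
  also have "\<dots> = (\<Sum>A\<in>J. prob A) * ln p" by (simp add: sum_distrib_right)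
  also have "\<dots> \<le> 1 * ln p" using le1 assms(5) by (intro mult_right_mono) auto
  finally show "partition_entropy M J \<le> ln p" by simp
qed

text \<open>The measure is concentrated on at most \<open>p\<close> points, so the entropies of all joins are bounded by
\<open>ln p\<close> and vanish after division by the length of the join.\<close>

lemma ks_entropy_empirical:
  assumes f: "f \<in> C01" and z: "z \<in> {0..1}" and p: "p > 0"
  shows "ks_entropy f (empirical f z p) \<le> 0"
  unfolding ks_entropy_def
proof (rule SUP_least)
  define \<mu> where "\<mu> = empirical f z p"
  have \<mu>: "\<mu> \<in> prob01" using empirical_in_prob01[OF f z p] by (simp add: \<mu>_def)
  fix P assume "P \<in> finite_partitions (empirical f z p)"
  then have P: "finite P" "P \<subseteq> sets borel01" "partition_on (space \<mu>) P"
    using \<mu> by (auto simp: finite_partitions_def \<mu>_def prob01_def)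
  have sub: "iterated_join \<mu> f P n \<subseteq> sets borel01" for n
  proof -
    have "{x \<in> {0..1}. \<forall>i<n. (f ^^ i) x \<in> c i} \<in> sets borel01" if "c \<in> {..<n} \<rightarrow>\<^sub>E P" for c
      using that P(2) by (intro cell_in_sets[OF f]) (auto simp: PiE_iff)
    then show ?thesis unfolding iterated_join_def prob01_space[OF \<mu>] by blast
  qed
  have "measure \<mu> A = 0 \<or> 1 / real p \<le> measure \<mu> A" if "A \<in> sets borel01" for A
    using measure_empirical[OF f z that, of p] p
    by (cases "card {j. j < p \<and> (f ^^ j) z \<in> A}") (auto simp: \<mu>_def divide_right_mono simp del: card_eq_0_iff)
  then have H: "0 \<le> partition_entropy \<mu> (iterated_join \<mu> f P n)"
      "partition_entropy \<mu> (iterated_join \<mu> f P n) \<le> ln p" for n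
    using \<mu> sub[of n] disjoint_iterated_join[OF P(3), of f n] p
    by (auto intro!: partition_entropy_bounds simp: prob01_def iterated_join_def P(1) finite_PiE)
  have "(\<lambda>n. partition_entropy \<mu> (iterated_join \<mu> f P n) / real n) \<longlonglongrightarrow> 0"
  proof (rule tendsto_sandwich[OF _ _ tendsto_const])
    show "(\<lambda>n. ln (real p) / real n) \<longlonglongrightarrow> 0" by (rule lim_const_over_n)
  qed (use H in \<open>auto intro!: always_eventually divide_right_mono\<close>)
  then have "entropy_wrt \<mu> f P = 0" unfolding entropy_wrt_def by (rule limI)
  then show "ereal (entropy_wrt (empirical f z p) f P) \<le> 0" by (simp add: \<mu>_def)
qed

section \<open>A measure of entropy \<open>ln 2\<close> on a horseshoe\<close>

lemma card_words_with_subword: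
  fixes u :: "nat \<Rightarrow> bool"
  assumes "r + k \<le> m"
  shows "card {g \<in> {..<m} \<rightarrow>\<^sub>E UNIV. \<forall>i<k. g (r + i) = u i} = 2 ^ (m - k)"
proof -
  have "{g \<in> {..<m} \<rightarrow>\<^sub>E UNIV. \<forall>i<k. g (r + i) = u i}
      = Pi\<^sub>E {..<m} (\<lambda>j. if j \<in> {r..<r + k} then {u (j - r)} else UNIV)" (is "?L = ?R")
  proof (intro equalityI subsetI)
    fix g assume g: "g \<in> ?L"
    have "g j = u (j - r)" if "j \<in> {r..<r + k}" for j
    proof -
      have "j - r < k" "r + (j - r) = j" using that by auto
      with g show ?thesis by fastforce
    qed
    then show "g \<in> ?R" using g by (auto simp: PiE_iff)
  next
    fix g assume g: "g \<in> ?R"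
    have "g (r + i) = u i" if "i < k" for i
      using PiE_mem[OF g, of "r + i"] that assms by simp
    then show "g \<in> ?L" using g by (auto simp: PiE_iff)
  qed
  also have "card \<dots> = (\<Prod>j<m. if j \<in> {r..<r + k} then 1 else 2)"
    by (simp add: card_PiE if_distrib[of card] cong: prod.cong if_cong)
  also have "\<dots> = 2 ^ card ({..<m} - {r..<r + k})"
    by (simp add: prod.If_cases Diff_eq atLeastLessThan_def atLeast_def lessThan_def Int_def)
  also have "card ({..<m} - {r..<r + k}) = m - k"
    using assms by (subst card_Diff_subset) auto
  finally show ?thesis .
qed

text \<open>The sequence is the concatenation of all \<open>2\<^sup>m\<close> words of length \<open>m\<close>, in any order. At each offset
\<open>r < m - k\<close>, a given word of length \<open>k\<close> is read in exactly \<open>2\<^sup>m\<^sup>-\<^sup>k\<close> of these blocks. So each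
word of length \<open>k\<close> has asymptotically, for \<open>m \<rightarrow> \<infinity>\<close>, at least its fair share \<open>2\<^sup>-\<^sup>k\<close> of the positions
\<open>j < m 2\<^sup>m\<close>. Leaving out the offset \<open>m - k\<close> makes \<open>j + k\<close> smaller than the total length. A single sequence is needed, because the measures to be approximated must be
carried by single periodic orbits.\<close>

lemma balanced_sequence:
  obtains \<sigma> :: "nat \<Rightarrow> bool" where
    "\<And>k u. k \<le> m \<Longrightarrow>
      (m - k) * 2 ^ (m - k) \<le> card {j. j + k < m * 2 ^ m \<and> (\<forall>i<k. \<sigma> (j + i) = u i)}"
proof -
  define W where "W = ({..<m} \<rightarrow>\<^sub>E (UNIV :: bool set))"
  have "finite W" "card W = 2 ^ m" by (simp_all add: W_def finite_PiE card_PiE)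
  then obtain e where e: "bij_betw e {..<2 ^ m :: nat} W"
    using ex_bij_betw_nat_finite[of W] by (auto simp: atLeast0LessThan)
  define \<sigma> where "\<sigma> j = e (j div m) (j mod m)" for j
  have "(m - k) * 2 ^ (m - k) \<le> card {j. j + k < m * 2 ^ m \<and> (\<forall>i<k. \<sigma> (j + i) = u i)}"
    if k: "k \<le> m" for k and u :: "nat \<Rightarrow> bool"
  proof -
    define Q where "Q r = {q \<in> {..<2 ^ m}. \<forall>i<k. e q (r + i) = u i}" for r
    have card_Q: "card (Q r) = 2 ^ (m - k)" if "r < m - k" for r
    proof -
      have "e ` Q r = {g \<in> W. \<forall>i<k. g (r + i) = u i}"
        unfolding Q_def using bij_betw_imp_surj_on[OF e] by auto
      moreover have "inj_on e (Q r)"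
        using bij_betw_imp_inj_on[OF e] by (rule inj_on_subset) (auto simp: Q_def)
      ultimately show ?thesis
        using card_words_with_subword[of r k m u] that card_image[of e "Q r"] by (simp add: W_def)
    qed
    have "(m - k) * 2 ^ (m - k) = card (SIGMA r:{..<m - k}. Q r)"
      using card_Q by (simp add: Q_def)
    also have "\<dots> = card ((\<lambda>(r, q). q * m + r) ` (SIGMA r:{..<m - k}. Q r))"
    proof (rule card_image[symmetric], rule inj_onI)
      fix x y
      assume xy: "x \<in> (SIGMA r:{..<m - k}. Q r)" "y \<in> (SIGMA r:{..<m - k}. Q r)"
        and eq: "(case x of (r, q) \<Rightarrow> q * m + r) = (case y of (r, q) \<Rightarrow> q * m + r)"
      have "fst x < m" "fst y < m" using xy by auto
      then have "fst x = (snd x * m + fst x) mod m" "snd x = (snd x * m + fst x) div m"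
        "fst y = (snd y * m + fst y) mod m" "snd y = (snd y * m + fst y) div m" by auto
      moreover have "snd x * m + fst x = snd y * m + fst y" using eq by (simp add: case_prod_beta)
      ultimately show "x = y" by (metis prod_eqI)
    qed
    also have "\<dots> \<le> card {j. j + k < m * 2 ^ m \<and> (\<forall>i<k. \<sigma> (j + i) = u i)}"
    proof (rule card_mono)
      show "finite {j. j + k < m * 2 ^ m \<and> (\<forall>i<k. \<sigma> (j + i) = u i)}"
        by (rule finite_subset[of _ "{..<m * 2 ^ m}"]) auto
      show "(\<lambda>(r, q). q * m + r) ` (SIGMA r:{..<m - k}. Q r)
          \<subseteq> {j. j + k < m * 2 ^ m \<and> (\<forall>i<k. \<sigma> (j + i) = u i)}"
      proof (rule image_subsetI)
        fix x assume "x \<in> (SIGMA r:{..<m - k}. Q r)"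
        then obtain r q where x: "x = (r, q)" and r: "r \<in> {..<m - k}" and q: "q \<in> Q r" by blast
        have "Suc q * m \<le> 2 ^ m * m" using q by (intro mult_right_mono) (auto simp: Q_def)
        then have "q * m + r + k < m * 2 ^ m" using r by (simp add: mult.commute)
        moreover have "\<sigma> (q * m + r + i) = u i" if "i < k" for i
        proof -
          have "r + i < m" using r that by auto
          then have "(q * m + r + i) div m = q" "(q * m + r + i) mod m = r + i"
            by (simp_all add: add.assoc)
          then show ?thesis using q that by (simp add: \<sigma>_def Q_def)
        qed
        ultimately show "(case x of (r, q) \<Rightarrow> q * m + r)
            \<in> {j. j + k < m * 2 ^ m \<and> (\<forall>i<k. \<sigma> (j + i) = u i)}" by (simp add: x)
      qed
    qed
    finally show ?thesis .
  qed
  then show ?thesis by (rule that)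
qed

text \<open>The part of the portmanteau theorem for closed sets: the indicator of \<open>F\<close> is the decreasing limit of
the continuous functions \<open>(1 - min 1 (infdist x F))\<^sup>j\<close>.\<close>

lemma closed_measure_limit_ge:
  assumes F: "closed F" "F \<subseteq> {0..1}" and \<nu>: "\<And>n. \<nu> n \<in> prob01" and \<mu>: "\<mu> \<in> prob01"
    and conv: "\<And>g. g \<in> C01 \<Longrightarrow> (\<lambda>n. integral\<^sup>L (\<nu> n) g) \<longlonglongrightarrow> integral\<^sup>L \<mu> g"
    and ge: "\<And>n. t n \<le> measure (\<nu> n) F" and t: "t \<longlonglongrightarrow> s" and "0 < s"
  shows "s \<le> measure \<mu> F"
proof -
  have "F \<noteq> {}"
  proof
    assume "F = {}"
    then have "s \<le> 0" using LIMSEQ_le_const2[OF t, of 0] ge by auto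
    with \<open>0 < s\<close> show False by simp
  qed
  have F_sets: "F \<in> sets borel01"
    using F by (auto simp: borel01_def sets_restrict_space)
  define \<phi> where "\<phi> j = restrict (\<lambda>x. (1 - min 1 (infdist x F)) ^ j) {0..1}" for j
  have \<phi>01: "\<phi> j x \<in> {0..1}" if "x \<in> {0..1}" for j x
    using that infdist_nonneg[of x F] by (auto simp: \<phi>_def intro!: power_le_one)
  have \<phi>: "\<phi> j \<in> C01" for j
  proof -
    have "continuous_on {0..1} (\<lambda>x. (1 - min 1 (infdist x F)) ^ j)"
      by (intro continuous_intros)
    then have "continuous_on {0..1} (\<phi> j)"
      by (rule continuous_on_eq) (simp add: \<phi>_def)
    then show ?thesis using \<phi>01 unfolding C01_iff by (auto simp: \<phi>_def)
  qed
  have ge\<phi>: "s \<le> integral\<^sup>L \<mu> (\<phi> j)" for j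
  proof (rule LIMSEQ_le[OF t conv[OF \<phi>]])
    have "t n \<le> integral\<^sup>L (\<nu> n) (\<phi> j)" for n
    proof -
      interpret prob_space "\<nu> n" using \<nu>[of n] by (simp add: prob01_def)
      have FM: "F \<in> sets (\<nu> n)" using F_sets \<nu>[of n] by (simp add: prob01_def)
      have "measure (\<nu> n) F = integral\<^sup>L (\<nu> n) (indicator F)" using FM by simp
      also have "\<dots> \<le> integral\<^sup>L (\<nu> n) (\<phi> j)"
      proof (rule integral_mono)
        fix x assume "x \<in> space (\<nu> n)"
        then have x: "x \<in> {0..1}" using prob01_space[OF \<nu>] by simp
        show "indicator F x \<le> \<phi> j x"
          using \<phi>01[OF x, of j] x by (cases "x \<in> F") (auto simp: \<phi>_def)
      qed (use FM C01_integrable[OF \<nu> \<phi>] in \<open>auto simp: emeasure_eq_measure intro!: integrable_real_indicator\<close>)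
      finally show ?thesis using ge[of n] by simp
    qed
    then show "\<exists>N. \<forall>n\<ge>N. t n \<le> integral\<^sup>L (\<nu> n) (\<phi> j)" by blast
  qed
  interpret prob_space \<mu> using \<mu> by (simp add: prob01_def)
  have FM: "F \<in> sets \<mu>" using F_sets \<mu> by (simp add: prob01_def)
  have "(\<lambda>j. integral\<^sup>L \<mu> (\<phi> j)) \<longlonglongrightarrow> integral\<^sup>L \<mu> (indicator F)"
  proof (rule integral_dominated_convergence[where w = "\<lambda>_. 1"])
    show "AE x in \<mu>. (\<lambda>j. \<phi> j x) \<longlonglongrightarrow> indicator F x"
    proof (rule AE_I2)
      fix x assume "x \<in> space \<mu>"
      then have x: "x \<in> {0..1}" using prob01_space[OF \<mu>] by simp
      show "(\<lambda>j. \<phi> j x) \<longlonglongrightarrow> indicator F x"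
      proof (cases "x \<in> F")
        case True
        then show ?thesis using x by (simp add: \<phi>_def)
      next
        case False
        then have "infdist x F > 0"
          using in_closed_iff_infdist_zero[OF F(1) \<open>F \<noteq> {}\<close>, of x] infdist_nonneg[of x F] by simp
        then have "(\<lambda>j. (1 - min 1 (infdist x F)) ^ j) \<longlonglongrightarrow> 0"
          by (intro LIMSEQ_realpow_zero) auto
        then show ?thesis using x False by (simp add: \<phi>_def)
      qed
    qed
    show "AE x in \<mu>. norm (\<phi> j x) \<le> 1" for j
      using \<phi>01 prob01_space[OF \<mu>] by (intro AE_I2) auto
  qed (use FM C01_integrable[OF \<mu> \<phi>] in auto)
  then have "(\<lambda>j. integral\<^sup>L \<mu> (\<phi> j)) \<longlonglongrightarrow> measure \<mu> F" using FM by simp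
  then show ?thesis using ge\<phi> by (intro LIMSEQ_le_const) auto
qed

text \<open>The periodic orbits follow the balanced sequences, and \<open>\<mu>\<close> is a limit of their measures. The sets of
points with a given itinerary of length \<open>k\<close> are closed, so that the frequencies of the words pass to
the limit as lower bounds.\<close>

lemma horseshoe_periodic_measures:
  assumes f: "f \<in> C01" and h: "horseshoe f a b c d"
  obtains z p \<mu> where
    "\<And>m. p m > 0" "\<And>m. (f ^^ p m) (z m) = z m" "\<And>m i. (f ^^ i) (z m) \<in> {a..d}"
    "\<mu> \<in> prob01"
    "\<And>g. g \<in> C01 \<Longrightarrow> (\<lambda>m. integral\<^sup>L (empirical f (z m) (p m)) g) \<longlonglongrightarrow> integral\<^sup>L \<mu> g"
    "\<And>k u. (1 / 2) ^ k \<le> measure \<mu> {x \<in> {0..1}. \<forall>i<k. (f ^^ i) x \<in> (if u i then {c..d} else {a..b})}"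
proof -
  have ord: "0 \<le> a" "a < b" "b < c" "c < d" "d \<le> 1" using h by (auto simp: horseshoe_def)
  define A where "A u = (if u then {c..d} else {a..b})" for u
  have A: "A u \<subseteq> {a..d}" for u using ord by (auto simp: A_def)
  define p where "p m = m * 2 ^ m" for m :: nat
  define balanced where "balanced m \<sigma> \<longleftrightarrow> (\<forall>k u. k \<le> m \<longrightarrow> (m - k) * 2 ^ (m - k)
      \<le> card {j. j + k < p m \<and> (\<forall>i<k. \<sigma> (j + i) = u i)})" for m and \<sigma> :: "nat \<Rightarrow> bool"
  have "\<exists>\<sigma>. balanced m \<sigma>" for m
    unfolding p_def balanced_def by (rule balanced_sequence[of m]) blast
  then obtain \<sigma> where "balanced m (\<sigma> m)" for m
    by metis
  then have \<sigma>: "(m - k) * 2 ^ (m - k) \<le> card {j. j + k < p m \<and> (\<forall>i<k. \<sigma> m (j + i) = u i)}"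
    if "k \<le> m" for m k u
    using that unfolding balanced_def by blast
  define follows where "follows m z \<longleftrightarrow>
      z \<in> {a..d} \<and> (f ^^ p m) z = z \<and> (\<forall>i<p m. (f ^^ i) z \<in> A (\<sigma> m i))" for m z
  have "\<exists>z. follows m z" for m
    using horseshoe_periodic_itinerary[OF f h, of "p m" "\<sigma> m"] unfolding A_def follows_def by blast
  then obtain z where z: "follows m (z m)" for m by metis
  have z: "z m \<in> {a..d}" "(f ^^ p m) (z m) = z m" "i < p m \<Longrightarrow> (f ^^ i) (z m) \<in> A (\<sigma> m i)" for m i
    using z[of m] by (auto simp: follows_def)
  have z01: "z m \<in> {0..1}" for m using z(1)[of m] ord by auto
  \<comment> \<open>the words of length \<open>0\<close> give the empty sequence, hence the shift of the index\<close>
  have p: "p (Suc m) > 0" for m by (simp add: p_def)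
  have orbit: "(f ^^ i) (z (Suc m)) \<in> {a..d}" for m i
  proof -
    have "(f ^^ i) (z (Suc m)) = (f ^^ (i mod p (Suc m))) (z (Suc m))"
      using funpow_mod_eq[OF z(2)] by simp
    also have "\<dots> \<in> {a..d}" using subsetD[OF A z(3)[of "i mod p (Suc m)" "Suc m"]] p[of m] by simp
    finally show ?thesis .
  qed
  define E where "E m = empirical f (z m) (p m)" for m
  have E: "E (Suc m) \<in> prob01" for m
    unfolding E_def using f z01 p by (rule empirical_in_prob01)
  obtain r \<mu> where r: "strict_mono (r :: nat \<Rightarrow> nat)" and \<mu>: "\<mu> \<in> prob01"
    and conv: "\<And>g. g \<in> C01 \<Longrightarrow> (\<lambda>m. integral\<^sup>L (E (Suc (r m))) g) \<longlonglongrightarrow> integral\<^sup>L \<mu> g"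
    using prob01_sequentially_compact[of "\<lambda>m. E (Suc m)"] E by blast
  have cyl: "(1 / 2) ^ k \<le> measure \<mu> {x \<in> {0..1}. \<forall>i<k. (f ^^ i) x \<in> A (u i)}" for k u
  proof -
    define F where "F = {x \<in> {0..1}. \<forall>i<k. (f ^^ i) x \<in> A (u i)}"
    have "closed ({0..1} \<inter> (f ^^ i) -` A v)" for i v
      by (rule continuous_closed_preimage[OF continuous_on_funpow[OF f]]) (auto simp: A_def)
    then have "closed ({0..1} \<inter> (\<Inter>i\<in>{..<k}. {0..1} \<inter> (f ^^ i) -` A (u i)))"
      by (intro closed_Int closed_INT) auto
    also have "{0..1} \<inter> (\<Inter>i\<in>{..<k}. {0..1} \<inter> (f ^^ i) -` A (u i)) = F"
      by (auto simp: F_def)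
    finally have F: "closed F" .
    have sub: "F \<subseteq> {0..1}" by (auto simp: F_def)
    have F_sets: "F \<in> sets borel01"
      unfolding borel01_def using borel_closed[OF F] sub by (simp add: sets_restrict_space_iff)
    \<comment> \<open>the frequency \<open>(m - k) 2\<^sup>m\<^sup>-\<^sup>k / (m 2\<^sup>m)\<close> provided by the balanced sequence\<close>
    define t where "t m = (1 - real k / real m) * (1 / 2) ^ k" for m :: nat
    have "t m \<le> measure (E m) F" if m: "m > 0" for m
    proof (cases "k \<le> m")
      case True
      have "{j. j + k < p m \<and> (\<forall>i<k. \<sigma> m (j + i) = u i)} \<subseteq> {j. j < p m \<and> (f ^^ j) (z m) \<in> F}"
      proof clarify
        fix j assume j: "j + k < p m" "\<forall>i<k. \<sigma> m (j + i) = u i"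
        have "(f ^^ i) ((f ^^ j) (z m)) \<in> A (u i)" if "i < k" for i
        proof -
          have "j + i < p m" using j(1) that by simp
          from z(3)[OF this] show ?thesis using j(2) that by (simp add: funpow_add add.commute[of j])
        qed
        then show "j < p m \<and> (f ^^ j) (z m) \<in> F"
          using j C01_funpow[OF f z01] by (auto simp: F_def)
      qed
      then have "(m - k) * 2 ^ (m - k) \<le> card {j. j < p m \<and> (f ^^ j) (z m) \<in> F}"
        by (intro order_trans[OF \<sigma>[OF True]] card_mono) auto
      then have "real ((m - k) * 2 ^ (m - k)) / real (p m) \<le> measure (E m) F"
        unfolding E_def measure_empirical[OF f z01 F_sets] by (intro divide_right_mono of_nat_mono) auto
      moreover have "real ((m - k) * 2 ^ (m - k)) / real (p m) = t m"
      proof -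
        have "(2 :: real) ^ (m - k) = 2 ^ m / 2 ^ k" using True by (simp add: power_diff)
        then have "real ((m - k) * 2 ^ (m - k)) = (real m - real k) * (2 ^ m / 2 ^ k)"
          using True by (simp add: of_nat_diff)
        then show ?thesis using m by (simp add: t_def p_def power_one_over field_simps)
      qed
      ultimately show ?thesis by simp
    next
      case False
      then have "t m \<le> 0" using m by (simp add: t_def mult_nonpos_nonneg field_simps)
      then show ?thesis by (rule order_trans) simp
    qed
    then have "t (Suc (r m)) \<le> measure (E (Suc (r m))) F" for m by simp
    moreover have "t \<longlonglongrightarrow> (1 - 0) * (1 / 2) ^ k"
      unfolding t_def by (intro tendsto_intros lim_const_over_n)
    then have "(\<lambda>m. t (Suc (r m))) \<longlonglongrightarrow> (1 / 2) ^ k"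
      using LIMSEQ_subseq_LIMSEQ[OF LIMSEQ_Suc r, of t "(1 / 2) ^ k"] by (simp add: o_def)
    ultimately show ?thesis
      unfolding F_def[symmetric]
      by (intro closed_measure_limit_ge[OF F sub E \<mu> conv]) auto
  qed
  show ?thesis
  proof (rule that[of "\<lambda>m. p (Suc (r m))" "\<lambda>m. z (Suc (r m))" \<mu>])
  qed (use p z(2) orbit \<mu> conv cyl in \<open>auto simp: E_def A_def\<close>)
qed

text \<open>The lower bounds on the \<open>2\<^sup>k\<close> disjoint cells of the join sum up to \<open>1\<close>, so they are
equalities and the entropy of the join is exactly \<open>k ln 2\<close>.\<close>

lemma ks_entropy_ge_ln2:
  assumes \<mu>: "\<mu> \<in> prob01" and f: "f \<in> C01" and h: "0 \<le> h" "h < 1"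
    and words: "\<And>k u. (1 / 2) ^ k \<le> measure \<mu>
      {x \<in> {0..1}. \<forall>i<k. (f ^^ i) x \<in> (if u i then {h<..1} else {0..h})}"
  shows "ereal (ln 2) \<le> ks_entropy f \<mu>"
proof -
  interpret prob_space \<mu> using \<mu> by (simp add: prob01_def)
  have sets: "sets \<mu> = sets borel01" and sp: "space \<mu> = {0..1}"
    using \<mu> prob01_space by (auto simp: prob01_def)
  define L R where "L = {0..h}" and "R = {h<..1}"
  have LR: "L \<noteq> R" "L \<inter> R = {}" "L \<union> R = {0..1}" "L \<noteq> {}" "R \<noteq> {}"
    using h by (auto simp: L_def R_def)
  have LR_sets: "L \<in> sets borel01" "R \<in> sets borel01"
    using h by (auto simp: borel01_def sets_restrict_space_iff L_def R_def)
  have P: "{L, R} \<in> finite_partitions \<mu>"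
    unfolding finite_partitions_def partition_on_def sets sp
    using LR LR_sets by (auto simp: disjoint_def)
  have H: "partition_entropy \<mu> (iterated_join \<mu> f {L, R} k) = real k * ln 2" for k
  proof -
    define W where "W = ({..<k} \<rightarrow>\<^sub>E {L, R})"
    define cell where "cell c = {x \<in> {0..1}. \<forall>i<k. (f ^^ i) x \<in> c i}" for c :: "nat \<Rightarrow> real set"
    have "card {L, R} = 2" using LR(1) by simp
    then have W: "finite W" "card W = 2 ^ k"
      unfolding W_def by (simp_all only: card_PiE finite_PiE finite_lessThan finite.intros
          prod_constant card_lessThan)
    have cell_sets: "cell c \<in> sets \<mu>" if "c \<in> W" for c
      unfolding sets cell_def using that LR_sets by (intro cell_in_sets[OF f]) (auto simp: W_def PiE_iff)
    have ge: "(1 / 2) ^ k \<le> prob (cell c)" if c: "c \<in> W" for c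
    proof -
      have "c i = (if c i = R then R else L)" if "i < k" for i
        using c that by (auto simp: W_def PiE_iff)
      then have "cell c = {x \<in> {0..1}. \<forall>i<k. (f ^^ i) x \<in> (if c i = R then R else L)}"
        unfolding cell_def by (intro Collect_cong conj_cong refl) metis
      then show ?thesis using words[of k "\<lambda>i. c i = R"] unfolding L_def R_def by simp
    qed
    have disj: "cell c \<inter> cell c' = {}" if c: "c \<in> W" "c' \<in> W" "c \<noteq> c'" for c c'
    proof -
      obtain i where i: "i < k" "c i \<noteq> c' i"
        using PiE_ext[of c "{..<k}" "\<lambda>_. {L, R}" c'] c by (auto simp: W_def)
      moreover have "c i \<in> {L, R}" "c' i \<in> {L, R}" using c i(1) unfolding W_def by (auto dest: PiE_mem)
      ultimately have "c i \<inter> c' i = {}" using LR(2) by blast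
      then show ?thesis using i(1) unfolding cell_def by blast
    qed
    have "prob (\<Union>c\<in>W. cell c) = (\<Sum>c\<in>W. prob (cell c))"
      using W(1) cell_sets disj
      by (intro finite_measure_finite_Union) (auto simp: disjoint_family_on_def)
    then have total: "(\<Sum>c\<in>W. prob (cell c)) \<le> 1" using prob_le_1 by metis
    \<comment> \<open>\<open>2\<^sup>k\<close> disjoint cells of measure at least \<open>2\<^sup>-\<^sup>k\<close> leave no slack\<close>
    have eq: "prob (cell c) = (1 / 2) ^ k" if c: "c \<in> W" for c
    proof (rule antisym[OF _ ge[OF c]], rule ccontr)
      assume "\<not> prob (cell c) \<le> (1 / 2) ^ k"
      then have "(\<Sum>c\<in>W. (1 / 2) ^ k) < (\<Sum>c\<in>W. prob (cell c))"
        using c ge by (intro sum_strict_mono_ex1 W(1)) (auto intro!: bexI[of _ c])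
      moreover have "(\<Sum>c\<in>W. (1 / 2 :: real) ^ k) = 1" using W(2) by (simp add: power_one_over)
      ultimately show False using total by simp
    qed
    have pos: "0 < prob (cell c)" if "c \<in> W" for c using eq[OF that] by simp
    have "inj_on cell W"
    proof (rule inj_onI, rule ccontr)
      fix c c' assume c: "c \<in> W" "c' \<in> W" "cell c = cell c'" "c \<noteq> c'"
      then have "cell c = {}" using disj[of c c'] by simp
      then show False using pos[OF c(1)] by simp
    qed
    moreover have "iterated_join \<mu> f {L, R} k = cell ` W"
    proof -
      have "{} \<notin> cell ` W" using pos by fastforce
      then show ?thesis unfolding iterated_join_def sp W_def[symmetric] cell_def[symmetric] by simp
    qed
    ultimately have "partition_entropy \<mu> (iterated_join \<mu> f {L, R} k)
        = - (\<Sum>c\<in>W. prob (cell c) * ln (prob (cell c)))"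
      by (simp add: partition_entropy_def sum.reindex)
    also have "\<dots> = - (\<Sum>c\<in>W. (1 / 2) ^ k * ln ((1 / 2) ^ k))"
      using eq by simp
    also have "\<dots> = real k * ln 2"
      using W(2) by (simp add: power_one_over ln_div ln_realpow)
    finally show ?thesis .
  qed
  \<comment> \<open>for \<open>n = 0\<close> the quotient is \<open>0\<close>\<close>
  have "(\<lambda>n. partition_entropy \<mu> (iterated_join \<mu> f {L, R} n) / real n) \<longlonglongrightarrow> ln 2"
  proof (rule tendsto_eventually, rule eventually_sequentiallyI)
    fix n :: nat assume "1 \<le> n"
    then show "partition_entropy \<mu> (iterated_join \<mu> f {L, R} n) / real n = ln 2"
      by (simp add: H)
  qed
  then have "entropy_wrt \<mu> f {L, R} = ln 2" unfolding entropy_wrt_def by (rule limI)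
  then show ?thesis unfolding ks_entropy_def by (metis SUP_upper P)
qed

text \<open>The measure on a horseshoe is a limit of periodic orbit measures, from which it inherits invariance
and pseudo-physicality. The point \<open>b\<close> splits \<open>[0,1]\<close> into two pieces that separate \<open>[a,b]\<close> from
\<open>[c,d]\<close>.\<close>

lemma horseshoe_measure:
  assumes \<Psi>: "dense_sequence \<Psi>" and f: "f \<in> C01"
    and shadow: "\<And>z p. z \<in> {0..1} \<Longrightarrow> p > 0 \<Longrightarrow> (f ^^ p) z = z \<Longrightarrow> shadowed f z"
    and h: "horseshoe f a b c d"
  obtains z p \<mu> where
    "\<And>m. p m > 0" "\<And>m. (f ^^ p m) (z m) = z m" "\<And>m i. (f ^^ i) (z m) \<in> {a..d}"
    "\<mu> \<in> invariant_measures f \<inter> pseudo_physical_measures \<Psi> f"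
    "(\<lambda>m. wdist \<Psi> (empirical f (z m) (p m)) \<mu>) \<longlonglongrightarrow> 0"
    "ereal (ln 2) \<le> ks_entropy f \<mu>"
proof -
  have ord: "0 \<le> a" "a < b" "b < c" "c < d" "d \<le> 1" using h by (auto simp: horseshoe_def)
  obtain z p \<mu> where p: "\<And>m. p m > 0" and z: "\<And>m. (f ^^ p m) (z m) = z m"
    and orbit: "\<And>m i. (f ^^ i) (z m) \<in> {a..d}" and \<mu>: "\<mu> \<in> prob01"
    and conv: "\<And>g. g \<in> C01 \<Longrightarrow> (\<lambda>m. integral\<^sup>L (empirical f (z m) (p m)) g) \<longlonglongrightarrow> integral\<^sup>L \<mu> g"
    and cyl: "\<And>k u. (1 / 2) ^ k \<le> measure \<mu> {x \<in> {0..1}. \<forall>i<k. (f ^^ i) x \<in> (if u i then {c..d} else {a..b})}"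
    by (rule horseshoe_periodic_measures[OF f h]) blast
  have z01: "z m \<in> {0..1}" for m using orbit[of 0 m] ord by simp
  have E: "empirical f (z m) (p m) \<in> prob01" for m
    using f z01 p by (rule empirical_in_prob01)
  have lim: "(\<lambda>m. wdist \<Psi> (empirical f (z m) (p m)) \<mu>) \<longlonglongrightarrow> 0"
    using \<Psi> by (intro wdist_tendsto_0[OF _ E \<mu> conv]) (simp_all add: dense_sequence_def)
  have inv: "\<mu> \<in> invariant_measures f"
    using invariant_measures_limit[OF f empirical_periodic_invariant[OF f z01 z p] \<mu> conv] .
  have pp: "\<mu> \<in> pseudo_physical_measures \<Psi> f"
    using pseudo_physical_limit[OF \<Psi> f pseudo_physical_periodic[OF \<Psi> f z01 z p shadow[OF z01 p z]] \<mu> lim] .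
  have "ereal (ln 2) \<le> ks_entropy f \<mu>"
  proof (rule ks_entropy_ge_ln2[OF \<mu> f, of b])
    fix k and u :: "nat \<Rightarrow> bool"
    interpret prob_space \<mu> using \<mu> by (simp add: prob01_def)
    have sub: "(if v then {c..d} else {a..b}) \<subseteq> (if v then {b<..1} else {0..b})" for v
      using ord by auto
    have "{b<..1} \<in> sets borel01" "{0..b} \<in> sets borel01"
      using ord by (auto simp: borel01_def sets_restrict_space_iff)
    then have "{x \<in> {0..1}. \<forall>i<k. (f ^^ i) x \<in> (if u i then {b<..1} else {0..b})} \<in> sets \<mu>"
      using cell_in_sets[OF f, of k "\<lambda>i. if u i then {b<..1} else {0..b}"] \<mu> by (simp add: prob01_def)
    moreover have "{x \<in> {0..1}. \<forall>i<k. (f ^^ i) x \<in> (if u i then {c..d} else {a..b})}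
        \<subseteq> {x \<in> {0..1}. \<forall>i<k. (f ^^ i) x \<in> (if u i then {b<..1} else {0..b})}"
      using sub by blast
    ultimately show "(1 / 2) ^ k \<le> prob {x \<in> {0..1}. \<forall>i<k. (f ^^ i) x \<in> (if u i then {b<..1} else {0..b})}"
      using cyl[of k u] finite_measure_mono order_trans by blast
  qed (use ord in auto)
  with p z orbit inv pp lim show ?thesis by (intro that[of p z \<mu>]) auto
qed

section \<open>Failure of semicontinuity\<close>

lemma not_upper_semicontinuous_mapI:
  assumes "limitin X x l sequentially" "h l < a" "\<And>n. a \<le> h (x n)"
  shows "\<not> upper_semicontinuous_map X h"
proof
  assume "upper_semicontinuous_map X h"
  then have "openin X {y \<in> topspace X. h y < a}" by (simp add: upper_semicontinuous_map_def)
  moreover have "l \<in> {y \<in> topspace X. h y < a}"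
    using assms(1,2) by (simp add: limitin_def)
  ultimately have "eventually (\<lambda>n. x n \<in> {y \<in> topspace X. h y < a}) sequentially"
    using assms(1) unfolding limitin_def by blast
  then show False using assms(3) by (auto simp: eventually_sequentially not_less[symmetric])
qed

lemma not_lower_semicontinuous_mapI:
  assumes "limitin X x l sequentially" "a < h l" "\<And>n. h (x n) \<le> a"
  shows "\<not> lower_semicontinuous_map X h"
proof
  assume "lower_semicontinuous_map X h"
  then have "openin X {y \<in> topspace X. a < h y}" by (simp add: lower_semicontinuous_map_def)
  moreover have "l \<in> {y \<in> topspace X. a < h y}"
    using assms(1,2) by (simp add: limitin_def)
  ultimately have "eventually (\<lambda>n. x n \<in> {y \<in> topspace X. a < h y}) sequentially"
    using assms(1) unfolding limitin_def by blast
  then show False using assms(3) by (auto simp: eventually_sequentially not_less[symmetric])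
qed

text \<open>All measures in the argument are both invariant and pseudo-physical, so the conclusion holds for any
set \<open>S\<close> containing these, in particular for either of the two sets of interest.

For a single horseshoe, measures of entropy \<open>0\<close> on periodic orbits converge to a measure of
entropy at least \<open>ln 2\<close>. Now let the diameters of the horseshoes tend to \<open>0\<close>. The \<open>n\<close>-th one has a fixed
point \<open>q n\<close>, and along a subsequence these converge to a fixed point \<open>q'\<close>. Along it, the measures of
entropy at least \<open>ln 2\<close> converge to the Dirac measure at \<open>q'\<close>, which has entropy \<open>0\<close>.\<close>

lemma entropy_not_semicontinuous:
  assumes \<Psi>: "dense_sequence \<Psi>" and f: "f \<in> C01"
    and shadow: "\<And>z p. z \<in> {0..1} \<Longrightarrow> p > 0 \<Longrightarrow> (f ^^ p) z = z \<Longrightarrow> shadowed f z"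
    and horseshoes: "\<And>n. f \<in> horseshoe_maps n"
    and S: "invariant_measures f \<inter> pseudo_physical_measures \<Psi> f \<subseteq> S"
  shows "\<not> upper_semicontinuous_map (subtopology (weak_star \<Psi>) S) (ks_entropy f)"
    and "\<not> lower_semicontinuous_map (subtopology (weak_star \<Psi>) S) (ks_entropy f)"
proof -
  interpret Metric_space prob01 "wdist \<Psi>" by (rule Metric_space_wdist[OF \<Psi>])
  have sub: "range \<Psi> \<subseteq> C01" using \<Psi> by (simp add: dense_sequence_def)
  have prob: "\<mu> \<in> prob01" if "\<mu> \<in> invariant_measures f \<inter> pseudo_physical_measures \<Psi> f" for \<mu>
    using that by (simp add: invariant_measures_def)
  have limI: "limitin (subtopology (weak_star \<Psi>) S) \<nu> \<mu> sequentially"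
    if "\<And>n. \<nu> n \<in> invariant_measures f \<inter> pseudo_physical_measures \<Psi> f"
      "\<mu> \<in> invariant_measures f \<inter> pseudo_physical_measures \<Psi> f" "(\<lambda>n. wdist \<Psi> (\<nu> n) \<mu>) \<longlonglongrightarrow> 0" for \<nu> \<mu>
    unfolding limitin_subtopology limitin_weak_star_iff[OF \<Psi>]
    using that S prob by (auto intro!: always_eventually)
  have periodic: "empirical f z p \<in> invariant_measures f \<inter> pseudo_physical_measures \<Psi> f"
    if "z \<in> {0..1}" "p > 0" "(f ^^ p) z = z" for z p
    using empirical_periodic_invariant[OF f that(1,3,2)]
      pseudo_physical_periodic[OF \<Psi> f that(1,3,2) shadow[OF that]] by blast
  \<comment> \<open>the data of the \<open>n\<close>-th horseshoe, bundled for a simultaneous choice over all \<open>n\<close>\<close>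
  define good where "good n a d q z p \<mu> \<longleftrightarrow> 0 \<le> a \<and> d \<le> 1 \<and> d - a < 1 / real (Suc n) \<and>
      q \<in> {a..d} \<and> f q = q \<and> (\<forall>m. p m > 0 \<and> (f ^^ p m) (z m) = z m \<and> (\<forall>i. (f ^^ i) (z m) \<in> {a..d})) \<and>
      \<mu> \<in> invariant_measures f \<inter> pseudo_physical_measures \<Psi> f \<and>
      (\<lambda>m. wdist \<Psi> (empirical f (z m) (p m)) \<mu>) \<longlonglongrightarrow> 0 \<and> ereal (ln 2) \<le> ks_entropy f \<mu>"
    for n a d q \<mu> and z :: "nat \<Rightarrow> real" and p :: "nat \<Rightarrow> nat"
  have "\<exists>a d q z p \<mu>. good n a d q z p \<mu>" for n
  proof -
    obtain a b c d where h: "horseshoe f a b c d" "d - a < 1 / real (Suc n)"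
      using horseshoes[of n] by (auto simp: horseshoe_maps_def)
    obtain q where "q \<in> {a..d}" "f q = q"
      using horseshoe_periodic_itinerary[OF f h(1), of 1 "\<lambda>_. False"] by auto
    moreover obtain z p \<mu> where "\<And>m. p m > 0" "\<And>m. (f ^^ p m) (z m) = z m" "\<And>m i. (f ^^ i) (z m) \<in> {a..d}"
      "\<mu> \<in> invariant_measures f \<inter> pseudo_physical_measures \<Psi> f"
      "(\<lambda>m. wdist \<Psi> (empirical f (z m) (p m)) \<mu>) \<longlonglongrightarrow> 0" "ereal (ln 2) \<le> ks_entropy f \<mu>"
      by (rule horseshoe_measure[OF \<Psi> f shadow h(1)]) blast+
    moreover have "0 \<le> a" "d \<le> 1" using h(1) by (auto simp: horseshoe_def)
    ultimately have "good n a d q z p \<mu>" using h(2) unfolding good_def by blast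
    then show ?thesis by blast
  qed
  then obtain a d q z p \<mu> where good: "good n (a n) (d n) (q n) (z n) (p n) (\<mu> n)" for n
    by metis
  have ad: "0 \<le> a n" "d n \<le> 1" "d n - a n < 1 / real (Suc n)"
    and q: "q n \<in> {a n..d n}" "f (q n) = q n"
    and p: "p n m > 0" and z: "(f ^^ p n m) (z n m) = z n m" and orbit: "(f ^^ i) (z n m) \<in> {a n..d n}"
    and \<mu>: "\<mu> n \<in> invariant_measures f \<inter> pseudo_physical_measures \<Psi> f"
    and lim: "(\<lambda>m. wdist \<Psi> (empirical f (z n m) (p n m)) (\<mu> n)) \<longlonglongrightarrow> 0"
    and ent: "ereal (ln 2) \<le> ks_entropy f (\<mu> n)" for n m i
    using good[of n] unfolding good_def by blast+
  have q01: "q n \<in> {0..1}" for n using q(1)[of n] ad[of n] by auto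
  have z01: "z n m \<in> {0..1}" for n m using orbit[of 0 n m] ad[of n] by auto
  have E: "empirical f (z n m) (p n m) \<in> invariant_measures f \<inter> pseudo_physical_measures \<Psi> f" for n m
    using periodic[OF z01 p z] .
  have ln2: "(0 :: ereal) < ereal (ln 2)" by simp
  show "\<not> lower_semicontinuous_map (subtopology (weak_star \<Psi>) S) (ks_entropy f)"
  proof (rule not_lower_semicontinuous_mapI)
    show "limitin (subtopology (weak_star \<Psi>) S) (\<lambda>m. empirical f (z 0 m) (p 0 m)) (\<mu> 0) sequentially"
      by (rule limI[OF E \<mu> lim])
    show "0 < ks_entropy f (\<mu> 0)" using ln2 ent[of 0] by (rule less_le_trans)
    show "ks_entropy f (empirical f (z 0 m) (p 0 m)) \<le> 0" for m
      using f z01 p by (rule ks_entropy_empirical)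
  qed
  obtain q' r where q': "q' \<in> {0..1}" and r: "strict_mono (r :: nat \<Rightarrow> nat)" and qlim: "(q \<circ> r) \<longlonglongrightarrow> q'"
    using compact_imp_seq_compact[of "{0..1::real}"] q01 unfolding seq_compact_def by (metis compact_Icc)
  have fq': "f q' = q'"
  proof -
    have "continuous_on {0..1} f" using f by (simp add: C01_iff)
    then have "(\<lambda>k. f ((q \<circ> r) k)) \<longlonglongrightarrow> f q'"
      using qlim q' by (rule continuous_on_tendsto_compose) (use q01 in auto)
    then have "(q \<circ> r) \<longlonglongrightarrow> f q'" by (simp add: q(2) o_def)
    then show ?thesis using qlim by (rule LIMSEQ_unique)
  qed
  have fixed: "(f ^^ i) q' = q'" for i by (induction i) (simp_all add: fq')
  define \<delta> where "\<delta> = empirical f q' 1"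
  have \<delta>: "\<delta> \<in> invariant_measures f \<inter> pseudo_physical_measures \<Psi> f"
    unfolding \<delta>_def using periodic[OF q', of 1] fq' by simp
  have lim': "(\<lambda>k. wdist \<Psi> (\<mu> (r k)) \<delta>) \<longlonglongrightarrow> 0"
  proof (rule LIMSEQ_I)
    fix e :: real assume e: "e > 0"
    obtain \<eta> where \<eta>: "\<eta> > 0"
      "\<And>f x y n. f \<in> C01 \<Longrightarrow> x \<in> {0..1} \<Longrightarrow> y \<in> {0..1} \<Longrightarrow> n > 0 \<Longrightarrow>
       (\<And>j. j < n \<Longrightarrow> \<bar>(f ^^ j) x - (f ^^ j) y\<bar> < \<eta>) \<Longrightarrow>
       wdist \<Psi> (empirical f x n) (empirical f y n) < e / 2"
      using wdist_empirical_close[OF sub half_gt_zero[OF e]] by blast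
    obtain K1 where K1: "\<And>k. k \<ge> K1 \<Longrightarrow> \<bar>q (r k) - q'\<bar> < \<eta> / 2"
      using LIMSEQ_D[OF qlim half_gt_zero[OF \<eta>(1)]] by auto
    obtain K2 where K2: "inverse (real (Suc K2)) < \<eta> / 2"
      using reals_Archimedean[OF half_gt_zero[OF \<eta>(1)]] by auto
    have "norm (wdist \<Psi> (\<mu> (r k)) \<delta> - 0) < e" if k: "k \<ge> max K1 K2" for k
    proof -
      have "real (Suc K2) \<le> real (Suc (r k))" using k seq_suble[OF r, of k] by simp
      then have "1 / real (Suc (r k)) \<le> inverse (real (Suc K2))"
        by (simp add: inverse_eq_divide frac_le)
      then have diam: "d (r k) - a (r k) < \<eta> / 2" using ad(3)[of "r k"] K2 by linarith
      have near: "\<bar>(f ^^ j) (z (r k) m) - (f ^^ j) q'\<bar> < \<eta>" for j m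
      proof -
        have "\<bar>(f ^^ j) (z (r k) m) - q (r k)\<bar> < \<eta> / 2"
          using orbit[of j "r k" m] q(1)[of "r k"] diam unfolding atLeastAtMost_iff by linarith
        moreover have "\<bar>q (r k) - q'\<bar> < \<eta> / 2" using K1 k by simp
        ultimately show ?thesis unfolding fixed by linarith
      qed
      have "wdist \<Psi> (empirical f (z (r k) m) (p (r k) m)) \<delta> < e / 2" for m
      proof -
        have "empirical f q' (p (r k) m) = \<delta>"
          using empirical_multiple_period[OF f q', of 1 "p (r k) m"] p fq' by (simp add: \<delta>_def)
        then show ?thesis using \<eta>(2)[OF f z01[of "r k" m] q' p[of "r k" m] near] by simp
      qed
      note close = this
      have "wdist \<Psi> (\<mu> (r k)) \<delta> \<le> e / 2"
      proof (rule LIMSEQ_le_const)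
        show "(\<lambda>m. wdist \<Psi> (empirical f (z (r k) m) (p (r k) m)) (\<mu> (r k)) + e / 2) \<longlonglongrightarrow> e / 2"
          using tendsto_add[OF lim[of "r k"] tendsto_const[of "e / 2"]] by simp
        have "wdist \<Psi> (\<mu> (r k)) \<delta> \<le> wdist \<Psi> (empirical f (z (r k) m) (p (r k) m)) (\<mu> (r k)) + e / 2" for m
          using triangle[OF prob[OF \<mu>] prob[OF E] prob[OF \<delta>], of "r k" "r k" m] close[of m]
            commute[of "\<mu> (r k)"] by simp
        then show "\<exists>N. \<forall>m\<ge>N. wdist \<Psi> (\<mu> (r k)) \<delta>
            \<le> wdist \<Psi> (empirical f (z (r k) m) (p (r k) m)) (\<mu> (r k)) + e / 2" by blast
      qed
      then show ?thesis using e by simp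
    qed
    then show "\<exists>K. \<forall>k\<ge>K. norm (wdist \<Psi> (\<mu> (r k)) \<delta> - 0) < e" by blast
  qed
  show "\<not> upper_semicontinuous_map (subtopology (weak_star \<Psi>) S) (ks_entropy f)"
  proof (rule not_upper_semicontinuous_mapI)
    show "limitin (subtopology (weak_star \<Psi>) S) (\<lambda>k. \<mu> (r k)) \<delta> sequentially"
      by (rule limI[OF \<mu> \<delta> lim'])
    have "ks_entropy f \<delta> \<le> 0" unfolding \<delta>_def using f q' by (rule ks_entropy_empirical) simp
    then show "ks_entropy f \<delta> < ereal (ln 2)" using ln2 by (rule le_less_trans)
    show "ereal (ln 2) \<le> ks_entropy f (\<mu> (r k))" for k by (rule ent)
  qed
qed

theorem corollary34:
  fixes \<Psi> :: "nat \<Rightarrow> real \<Rightarrow> real"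
  assumes "dense_sequence \<Psi>"
  shows "typical (\<lambda>f.
      \<not> upper_semicontinuous_map
          (subtopology (weak_star \<Psi>) (invariant_measures f)) (ks_entropy f) \<and>
      \<not> lower_semicontinuous_map
          (subtopology (weak_star \<Psi>) (invariant_measures f)) (ks_entropy f) \<and>
      \<not> upper_semicontinuous_map
          (subtopology (weak_star \<Psi>) (pseudo_physical_measures \<Psi> f)) (ks_entropy f) \<and>
      \<not> lower_semicontinuous_map
          (subtopology (weak_star \<Psi>) (pseudo_physical_measures \<Psi> f)) (ks_entropy f))"
proof -
  define T where "T = mtopology_of C01_metric"
  define D where "D = (\<lambda>(qs, k). trapping_maps qs k \<union> (topspace T - T closure_of trapping_maps qs k))"
  show ?thesis
  proof (rule typicalI)
    show "countable (range D \<union> range horseshoe_maps)" by simp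
    show "range D \<union> range horseshoe_maps \<noteq> {}" by simp
  next
    fix U assume "U \<in> range D \<union> range horseshoe_maps"
    moreover have "openin T (trapping_maps qs k)" for qs k
      unfolding T_def by (rule openin_trapping_maps)
    ultimately show "openin (mtopology_of C01_metric) U" "mtopology_of C01_metric closure_of U = C01"
      using open_dense_Un_exterior[of T] openin_horseshoe_maps dense_horseshoe_maps
      by (auto simp: D_def T_def)
  next
    fix f assume f: "f \<in> C01" and gen: "f \<in> \<Inter>(range D \<union> range horseshoe_maps)"
    have "f \<in> D (qs, k)" for qs k using gen by blast
    then have "f \<in> trapping_maps qs k \<or> f \<notin> mtopology_of C01_metric closure_of trapping_maps qs k" for qs k
      unfolding D_def T_def by blast
    then have shadow: "shadowed f z" if "z \<in> {0..1}" "p > 0" "(f ^^ p) z = z" for z p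
      using periodic_shadowed[OF f _ that(1,3,2)] by blast
    have horseshoes: "f \<in> horseshoe_maps n" for n using gen by blast
    note * = entropy_not_semicontinuous[OF assms f shadow horseshoes]
    show "\<not> upper_semicontinuous_map
          (subtopology (weak_star \<Psi>) (invariant_measures f)) (ks_entropy f) \<and>
      \<not> lower_semicontinuous_map
          (subtopology (weak_star \<Psi>) (invariant_measures f)) (ks_entropy f) \<and>
      \<not> upper_semicontinuous_map
          (subtopology (weak_star \<Psi>) (pseudo_physical_measures \<Psi> f)) (ks_entropy f) \<and>
      \<not> lower_semicontinuous_map
          (subtopology (weak_star \<Psi>) (pseudo_physical_measures \<Psi> f)) (ks_entropy f)"
      by (intro conjI *) auto
  qed
qed

end
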